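(* Let $A$ be a symmetric $\mathcal{O}$-algebra such that $K\otimes_{\mathcal{O}}A$ is split semisimple, and assume that $A$ has the projective scalar property. Assume that $U$ is an $A$-lattice which is both projective and Knörr. Then $U/\pi U$ is a simple $A/\pi A$-module. In particular, $K\otimes_{\mathcal{O}}U$ is an irreducible $K\otimes_{\mathcal{O}}A$-module.
   Context: Let $p$ be a prime. $\mathcal{O}$ is a complete discrete valuation ring with maximal ideal $J(\mathcal{O})=\pi\mathcal{O}$, residue field $k=\mathcal{O}/J(\mathcal{O})$ of characteristic $p$, and field of fractions $K$ of characteristic $0$. An $\mathcal{O}$-algebra $A$ is symmetric if it is isomorphic to its $\mathcal{O}$-dual $A^*=\mathrm{Hom}_{\mathcal{O}}(A,\mathcal{O})$ as an $A$-$A$-bimodule (so $A$ is free of finite rank over $\mathcal{O}$). The image $s\in A^*$ of $1_A$ under a bimodule isomorphism $A\cong A^*$ is called a symmetrising form. Given a symmetrising form $s$ and an $\mathcal{O}$-basis $X$ of $A$ with dual basis $X^\vee=\{x^\vee : x\in X\}$ (that is, $s(xx^\vee)=1$ and $s(xy^\vee)=0$ for $x\ne y$ in $X$), the relative projective element of $A$ with respect to $s$ is $z_A=\sum_{x\in X}xx^\vee\in Z(A)$; it is independent of $X$. $A$ has the projective scalar property if there is a symmetrising form $s$ of $A$ whose relative projective element is $z_A=\lambda1_A$ for some $\lambda\in\mathcal{O}$. An $A$-lattice is a left unital $A$-module which is free of finite rank over $\mathcal{O}$. An indecomposable $A$-lattice $U$ is a Knörr lattice if the linear trace $\mathrm{tr}_U:\mathrm{End}_{\mathcal{O}}(U)\to\mathcal{O}$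 satisfies $\mathrm{tr}_U(\alpha)\mathcal{O}\subseteq\mathrm{rk}_{\mathcal{O}}(U)\mathcal{O}$ for every $\alpha\in\mathrm{End}_A(U)$, with equality precisely when $\alpha$ is an automorphism. *)

theory Defs
  imports "HOL-Algebra.Algebra"
begin

section \<open>The ground rings\<close>

definition has_characteristic :: "('a, 'm) ring_scheme \<Rightarrow> nat \<Rightarrow> bool" where
  "has_characteristic R n \<longleftrightarrow> (\<forall>m::nat. [m] \<cdot>\<^bsub>R\<^esub> \<one>\<^bsub>R\<^esub> = \<zero>\<^bsub>R\<^esub> \<longleftrightarrow> n dvd m)"

definition discrete_valuation_ring :: "'a ring \<Rightarrow> bool" where
  "discrete_valuation_ring R \<longleftrightarrow>
     principal_domain R \<and> \<not> field R \<and> (\<exists>!I. maximalideal I R)"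

definition adic_cauchy :: "'a ring \<Rightarrow> 'a \<Rightarrow> (nat \<Rightarrow> 'a) \<Rightarrow> bool" where
  "adic_cauchy R \<pi> x \<longleftrightarrow>
     (\<forall>n::nat. \<exists>N. \<forall>i\<ge>N. \<forall>j\<ge>N. x i \<ominus>\<^bsub>R\<^esub> x j \<in> PIdl\<^bsub>R\<^esub> (\<pi> [^]\<^bsub>R\<^esub> n))"

definition adic_limit :: "'a ring \<Rightarrow> 'a \<Rightarrow> (nat \<Rightarrow> 'a) \<Rightarrow> 'a \<Rightarrow> bool" where
  "adic_limit R \<pi> x l \<longleftrightarrow>
     (\<forall>n::nat. \<exists>N. \<forall>i\<ge>N. x i \<ominus>\<^bsub>R\<^esub> l \<in> PIdl\<^bsub>R\<^esub> (\<pi> [^]\<^bsub>R\<^esub> n))"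

definition complete_dvr :: "'a ring \<Rightarrow> 'a \<Rightarrow> bool" where
  "complete_dvr R \<pi> \<longleftrightarrow>
     discrete_valuation_ring R \<and> \<pi> \<in> carrier R \<and> maximalideal (PIdl\<^bsub>R\<^esub> \<pi>) R \<and>
     (\<forall>x. (\<forall>i. x i \<in> carrier R) \<and> adic_cauchy R \<pi> x \<longrightarrow> (\<exists>l\<in>carrier R. adic_limit R \<pi> x l))"

definition fraction_field :: "'a ring \<Rightarrow> 'k ring \<Rightarrow> ('a \<Rightarrow> 'k) \<Rightarrow> bool" where
  "fraction_field R K \<iota> \<longleftrightarrow>
     field K \<and> \<iota> \<in> ring_hom R K \<and> inj_on \<iota> (carrier R) \<and>
     (\<forall>x\<in>carrier K. \<exists>a\<in>carrier R. \<exists>b\<in>carrier R - {\<zero>\<^bsub>R\<^esub>}. x = \<iota> a \<otimes>\<^bsub>K\<^esub> inv\<^bsub>K\<^esub> (\<iota> b))"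


section \<open>Modules over noncommutative rings\<close>

text \<open>
  The record \<^type>\<open>module\<close> is used for modules over arbitrary rings and for algebras; the fields
  \<open>mult\<close> and \<open>one\<close> are meaningful only for algebras. The library locales \<^locale>\<open>module\<close> and
  \<^locale>\<open>algebra\<close> force the scalars, respectively the algebra, to be commutative. The locale
  \<^locale>\<open>submodule\<close> does not and is used as it stands.
\<close>

locale left_module = R?: ring R + M?: abelian_group M
  for R :: "('a, 'm) ring_scheme" (structure) and M :: "('a, 'b, 'n) module_scheme" (structure) +
  assumes smult_closed:
      "\<lbrakk>a \<in> carrier R; x \<in> carrier M\<rbrakk> \<Longrightarrow> a \<odot>\<^bsub>M\<^esub> x \<in> carrier M"
    and smult_l_distr:
      "\<lbrakk>a \<in> carrier R; b \<in> carrier R; x \<in> carrier M\<rbrakk> \<Longrightarrow>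
       (a \<oplus> b) \<odot>\<^bsub>M\<^esub> x = a \<odot>\<^bsub>M\<^esub> x \<oplus>\<^bsub>M\<^esub> b \<odot>\<^bsub>M\<^esub> x"
    and smult_r_distr:
      "\<lbrakk>a \<in> carrier R; x \<in> carrier M; y \<in> carrier M\<rbrakk> \<Longrightarrow>
       a \<odot>\<^bsub>M\<^esub> (x \<oplus>\<^bsub>M\<^esub> y) = a \<odot>\<^bsub>M\<^esub> x \<oplus>\<^bsub>M\<^esub> a \<odot>\<^bsub>M\<^esub> y"
    and smult_assoc:
      "\<lbrakk>a \<in> carrier R; b \<in> carrier R; x \<in> carrier M\<rbrakk> \<Longrightarrow>
       (a \<otimes> b) \<odot>\<^bsub>M\<^esub> x = a \<odot>\<^bsub>M\<^esub> (b \<odot>\<^bsub>M\<^esub> x)"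
    and smult_unital:
      "x \<in> carrier M \<Longrightarrow> \<one> \<odot>\<^bsub>M\<^esub> x = x"

locale assoc_algebra = module R A + A?: ring A
  for R :: "('r, 'm) ring_scheme" (structure) and A :: "('r, 'a, 'n) module_scheme" (structure) +
  assumes smult_mult_left:
      "\<lbrakk>r \<in> carrier R; x \<in> carrier A; y \<in> carrier A\<rbrakk> \<Longrightarrow>
       (r \<odot>\<^bsub>A\<^esub> x) \<otimes>\<^bsub>A\<^esub> y = r \<odot>\<^bsub>A\<^esub> (x \<otimes>\<^bsub>A\<^esub> y)"
    and smult_mult_right:
      "\<lbrakk>r \<in> carrier R; x \<in> carrier A; y \<in> carrier A\<rbrakk> \<Longrightarrow>
       x \<otimes>\<^bsub>A\<^esub> (r \<odot>\<^bsub>A\<^esub> y) = r \<odot>\<^bsub>A\<^esub> (x \<otimes>\<^bsub>A\<^esub> y)"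

definition module_homs :: "'a ring \<Rightarrow> ('a, 'b) module \<Rightarrow> ('a, 'c) module \<Rightarrow> ('b \<Rightarrow> 'c) set" where
  "module_homs R M N =
     {f \<in> carrier M \<rightarrow> carrier N.
        (\<forall>x\<in>carrier M. \<forall>y\<in>carrier M. f (x \<oplus>\<^bsub>M\<^esub> y) = f x \<oplus>\<^bsub>N\<^esub> f y) \<and>
        (\<forall>a\<in>carrier R. \<forall>x\<in>carrier M. f (a \<odot>\<^bsub>M\<^esub> x) = a \<odot>\<^bsub>N\<^esub> f x)}"

definition internal_direct_sum :: "'a ring \<Rightarrow> ('a, 'b) module \<Rightarrow> 'b set \<Rightarrow> 'b set \<Rightarrow> bool" where
  "internal_direct_sum R M P Q \<longleftrightarrow>
     submodule P R M \<and> submodule Q R M \<and> P \<inter> Q = {\<zero>\<^bsub>M\<^esub>} \<and> P <+>\<^bsub>M\<^esub> Q = carrier M"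

definition indecomposable_module :: "'a ring \<Rightarrow> ('a, 'b) module \<Rightarrow> bool" where
  "indecomposable_module R M \<longleftrightarrow>
     carrier M \<noteq> {\<zero>\<^bsub>M\<^esub>} \<and>
     (\<forall>P Q. internal_direct_sum R M P Q \<longrightarrow> P = {\<zero>\<^bsub>M\<^esub>} \<or> Q = {\<zero>\<^bsub>M\<^esub>})"

definition simple_module :: "'a ring \<Rightarrow> ('a, 'b) module \<Rightarrow> bool" where
  "simple_module R M \<longleftrightarrow>
     left_module R M \<and> carrier M \<noteq> {\<zero>\<^bsub>M\<^esub>} \<and>
     (\<forall>N. submodule N R M \<longrightarrow> N = {\<zero>\<^bsub>M\<^esub>} \<or> N = carrier M)"

definition semisimple_module :: "'a ring \<Rightarrow> ('a, 'b) module \<Rightarrow> bool" where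
  "semisimple_module R M \<longleftrightarrow>
     left_module R M \<and>
     (\<forall>N. submodule N R M \<and>
          (\<forall>S. submodule S R M \<and> simple_module R (M\<lparr>carrier := S\<rparr>) \<longrightarrow> S \<subseteq> N)
          \<longrightarrow> N = carrier M)"

definition free_left_module :: "'a ring \<Rightarrow> 'i set \<Rightarrow> ('a, 'i \<Rightarrow> 'a) module" where
  "free_left_module R I =
     \<lparr>carrier = {f. (\<forall>i\<in>I. f i \<in> carrier R) \<and> (\<forall>i. i \<notin> I \<longrightarrow> f i = \<zero>\<^bsub>R\<^esub>) \<and>
                    finite {i \<in> I. f i \<noteq> \<zero>\<^bsub>R\<^esub>}},
      monoid.mult = undefined, one = undefined,
      ring.zero = (\<lambda>_. \<zero>\<^bsub>R\<^esub>), add = (\<lambda>f g i. f i \<oplus>\<^bsub>R\<^esub> g i),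
      module.smult = (\<lambda>a f i. a \<otimes>\<^bsub>R\<^esub> f i)\<rparr>"

text \<open>
  Projective means isomorphic to a direct summand of a free module. Index sets in the type of
  elements of \<open>M\<close> suffice, since \<open>M\<close> is a quotient of the free module on its own carrier.
\<close>

definition projective_module :: "'a ring \<Rightarrow> ('a, 'b) module \<Rightarrow> bool" where
  "projective_module R M \<longleftrightarrow>
     left_module R M \<and>
     (\<exists>(I :: 'b set) P Q h.
        internal_direct_sum R (free_left_module R I) P Q \<and>
        h \<in> module_homs R M ((free_left_module R I)\<lparr>carrier := P\<rparr>) \<and>
        bij_betw h (carrier M) P)"

text \<open>
  The quotient of an \<open>R\<close>-module by a submodule \<open>N\<close>, as a module over a quotient ring of \<open>R\<close> whose
  ideal sends \<open>M\<close> into \<open>N\<close>. The scalars are cosets, as in \<^const>\<open>FactRing\<close>.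
\<close>

definition quotient_module :: "('a, 'b) module \<Rightarrow> 'b set \<Rightarrow> ('a set, 'b set) module" where
  "quotient_module M N =
     \<lparr>carrier = a_rcosets\<^bsub>M\<^esub> N, monoid.mult = undefined, one = undefined,
      ring.zero = N, add = set_add M,
      module.smult = (\<lambda>C D. \<Union>a\<in>C. \<Union>x\<in>D. N +>\<^bsub>M\<^esub> (a \<odot>\<^bsub>M\<^esub> x))\<rparr>"


section \<open>Bases, rank and trace\<close>

definition finite_basis :: "'r ring \<Rightarrow> ('r, 'b) module \<Rightarrow> 'b set \<Rightarrow> bool" where
  "finite_basis R M B \<longleftrightarrow>
     finite B \<and> B \<subseteq> carrier M \<and>
     (\<forall>x\<in>carrier M. \<exists>!c. c \<in> B \<rightarrow>\<^sub>E carrier R \<and> x = (\<Oplus>\<^bsub>M\<^esub>b\<in>B. c b \<odot>\<^bsub>M\<^esub> b))"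

definition free_of_finite_rank :: "'r ring \<Rightarrow> ('r, 'b) module \<Rightarrow> bool" where
  "free_of_finite_rank R M \<longleftrightarrow> (\<exists>B. finite_basis R M B)"

definition coordinates :: "'r ring \<Rightarrow> ('r, 'b) module \<Rightarrow> 'b set \<Rightarrow> 'b \<Rightarrow> 'b \<Rightarrow> 'r" where
  "coordinates R M B x =
     (THE c. c \<in> B \<rightarrow>\<^sub>E carrier R \<and> x = (\<Oplus>\<^bsub>M\<^esub>b\<in>B. c b \<odot>\<^bsub>M\<^esub> b))"

definition chosen_basis :: "'r ring \<Rightarrow> ('r, 'b) module \<Rightarrow> 'b set" where
  "chosen_basis R M = (SOME B. finite_basis R M B)"

text \<open>Over a nonzero commutative ring neither rank nor trace depends on the chosen basis.\<close>

definition free_rank :: "'r ring \<Rightarrow> ('r, 'b) module \<Rightarrow> nat" where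
  "free_rank R M = card (chosen_basis R M)"

definition linear_trace :: "'r ring \<Rightarrow> ('r, 'b) module \<Rightarrow> ('b \<Rightarrow> 'b) \<Rightarrow> 'r" where
  "linear_trace R M f =
     (\<Oplus>\<^bsub>R\<^esub>b\<in>chosen_basis R M. coordinates R M (chosen_basis R M) (f b) b)"


section \<open>Symmetric algebras\<close>

definition linear_forms :: "'r ring \<Rightarrow> ('r, 'b) module \<Rightarrow> ('b \<Rightarrow> 'r) set" where
  "linear_forms R M =
     {f \<in> carrier M \<rightarrow>\<^sub>E carrier R.
        (\<forall>x\<in>carrier M. \<forall>y\<in>carrier M. f (x \<oplus>\<^bsub>M\<^esub> y) = f x \<oplus>\<^bsub>R\<^esub> f y) \<and>
        (\<forall>r\<in>carrier R. \<forall>x\<in>carrier M. f (r \<odot>\<^bsub>M\<^esub> x) = r \<otimes>\<^bsub>R\<^esub> f x)}"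

text \<open>
  Isomorphisms of bimodules from \<open>A\<close> to its dual, on which \<open>A\<close> acts by
  \<open>(a \<cdot> f \<cdot> b) c = f (b c a)\<close>.
\<close>

definition dual_bimodule_isos :: "'r ring \<Rightarrow> ('r, 'a) module \<Rightarrow> ('a \<Rightarrow> 'a \<Rightarrow> 'r) set" where
  "dual_bimodule_isos R A =
     {\<Phi>. bij_betw \<Phi> (carrier A) (linear_forms R A) \<and>
         (\<forall>x\<in>carrier A. \<forall>y\<in>carrier A. \<forall>c\<in>carrier A. \<Phi> (x \<oplus>\<^bsub>A\<^esub> y) c = \<Phi> x c \<oplus>\<^bsub>R\<^esub> \<Phi> y c) \<and>
         (\<forall>a\<in>carrier A. \<forall>x\<in>carrier A. \<forall>b\<in>carrier A. \<forall>c\<in>carrier A.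
            \<Phi> (a \<otimes>\<^bsub>A\<^esub> x \<otimes>\<^bsub>A\<^esub> b) c = \<Phi> x (b \<otimes>\<^bsub>A\<^esub> c \<otimes>\<^bsub>A\<^esub> a))}"

definition symmetrising_form :: "'r ring \<Rightarrow> ('r, 'a) module \<Rightarrow> ('a \<Rightarrow> 'r) \<Rightarrow> bool" where
  "symmetrising_form R A s \<longleftrightarrow> (\<exists>\<Phi>\<in>dual_bimodule_isos R A. s = \<Phi> \<one>\<^bsub>A\<^esub>)"

definition symmetric_algebra :: "'r ring \<Rightarrow> ('r, 'a) module \<Rightarrow> bool" where
  "symmetric_algebra R A \<longleftrightarrow>
     assoc_algebra R A \<and> free_of_finite_rank R A \<and> dual_bimodule_isos R A \<noteq> {}"

definition dual_basis ::
  "'r ring \<Rightarrow> ('r, 'a) module \<Rightarrow> ('a \<Rightarrow> 'r) \<Rightarrow> 'a set \<Rightarrow> ('a \<Rightarrow> 'a) \<Rightarrow> bool" where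
  "dual_basis R A s E d \<longleftrightarrow>
     inj_on d E \<and> finite_basis R A (d ` E) \<and>
     (\<forall>x\<in>E. \<forall>y\<in>E. s (x \<otimes>\<^bsub>A\<^esub> d y) = (if x = y then \<one>\<^bsub>R\<^esub> else \<zero>\<^bsub>R\<^esub>))"

text \<open>
  \<open>z\<close> is the relative projective element with respect to \<open>s\<close>. It does not depend on the basis
  \<open>E\<close>, so asking for some basis is the same as asking for all of them.
\<close>

definition relative_projective_element ::
  "'r ring \<Rightarrow> ('r, 'a) module \<Rightarrow> ('a \<Rightarrow> 'r) \<Rightarrow> 'a \<Rightarrow> bool" where
  "relative_projective_element R A s z \<longleftrightarrow>
     (\<exists>E d. finite_basis R A E \<and> dual_basis R A s E d \<and> z = (\<Oplus>\<^bsub>A\<^esub>x\<in>E. x \<otimes>\<^bsub>A\<^esub> d x))"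

definition projective_scalar_property :: "'r ring \<Rightarrow> ('r, 'a) module \<Rightarrow> bool" where
  "projective_scalar_property R A \<longleftrightarrow>
     (\<exists>s. symmetrising_form R A s \<and>
          (\<exists>l\<in>carrier R. relative_projective_element R A s (l \<odot>\<^bsub>A\<^esub> \<one>\<^bsub>A\<^esub>)))"


section \<open>Lattices\<close>

definition underlying_ring :: "('r, 'a) module \<Rightarrow> 'a ring" where
  "underlying_ring A =
     \<lparr>carrier = carrier A, monoid.mult = monoid.mult A, one = one A,
      ring.zero = ring.zero A, add = add A\<rparr>"

definition restrict_scalars :: "('r, 'a) module \<Rightarrow> ('a, 'u) module \<Rightarrow> ('r, 'u) module" where
  "restrict_scalars A U =
     \<lparr>carrier = carrier U, monoid.mult = monoid.mult U, one = one U,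
      ring.zero = ring.zero U, add = add U,
      module.smult = (\<lambda>r u. (r \<odot>\<^bsub>A\<^esub> \<one>\<^bsub>A\<^esub>) \<odot>\<^bsub>U\<^esub> u)\<rparr>"

definition lattice_over :: "'r ring \<Rightarrow> ('r, 'a) module \<Rightarrow> ('a, 'u) module \<Rightarrow> bool" where
  "lattice_over R A U \<longleftrightarrow>
     left_module (underlying_ring A) U \<and> free_of_finite_rank R (restrict_scalars A U)"

definition knorr_lattice :: "'r ring \<Rightarrow> ('r, 'a) module \<Rightarrow> ('a, 'u) module \<Rightarrow> bool" where
  "knorr_lattice R A U \<longleftrightarrow>
     lattice_over R A U \<and> indecomposable_module (underlying_ring A) U \<and>
     (\<forall>\<alpha>\<in>module_homs (underlying_ring A) U U.
        let trace_ideal = PIdl\<^bsub>R\<^esub> (linear_trace R (restrict_scalars A U) \<alpha>);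
            rank_ideal = PIdl\<^bsub>R\<^esub> ([free_rank R (restrict_scalars A U)] \<cdot>\<^bsub>R\<^esub> \<one>\<^bsub>R\<^esub>)
        in trace_ideal \<subseteq> rank_ideal \<and>
           (trace_ideal = rank_ideal \<longleftrightarrow> bij_betw \<alpha> (carrier U) (carrier U)))"


section \<open>Tensor products and extension of scalars\<close>

type_synonym ('m, 'n) tensor = "('m \<times> 'n \<Rightarrow>\<^sub>0 int) set"

text \<open>
  The tensor product of two modules over a commutative ring is the free abelian group on pairs
  modulo the usual relations, so its elements are cosets of formal sums.
\<close>

definition tensor_relations ::
  "'r ring \<Rightarrow> ('r, 'm) module \<Rightarrow> ('r, 'n) module \<Rightarrow> ('m \<times> 'n \<Rightarrow>\<^sub>0 int) set" where
  "tensor_relations R M N =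
     {frag_of (x \<oplus>\<^bsub>M\<^esub> x', y) - frag_of (x, y) - frag_of (x', y) | x x' y.
        x \<in> carrier M \<and> x' \<in> carrier M \<and> y \<in> carrier N} \<union>
     {frag_of (x, y \<oplus>\<^bsub>N\<^esub> y') - frag_of (x, y) - frag_of (x, y') | x y y'.
        x \<in> carrier M \<and> y \<in> carrier N \<and> y' \<in> carrier N} \<union>
     {frag_of (r \<odot>\<^bsub>M\<^esub> x, y) - frag_of (x, r \<odot>\<^bsub>N\<^esub> y) | r x y.
        r \<in> carrier R \<and> x \<in> carrier M \<and> y \<in> carrier N}"

definition tensor_kernel ::
  "'r ring \<Rightarrow> ('r, 'm) module \<Rightarrow> ('r, 'n) module \<Rightarrow> ('m \<times> 'n \<Rightarrow>\<^sub>0 int) set" where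
  "tensor_kernel R M N =
     generate (free_Abelian_group (carrier M \<times> carrier N)) (tensor_relations R M N)"

definition tensor_product ::
  "'r ring \<Rightarrow> ('r, 'm) module \<Rightarrow> ('r, 'n) module \<Rightarrow> ('m, 'n) tensor monoid" where
  "tensor_product R M N =
     free_Abelian_group (carrier M \<times> carrier N) Mod tensor_kernel R M N"

definition tensor_class ::
  "'r ring \<Rightarrow> ('r, 'm) module \<Rightarrow> ('r, 'n) module \<Rightarrow> ('m \<times> 'n \<Rightarrow>\<^sub>0 int) \<Rightarrow> ('m, 'n) tensor" where
  "tensor_class R M N f =
     tensor_kernel R M N #>\<^bsub>free_Abelian_group (carrier M \<times> carrier N)\<^esub> f"

definition frag_extend2 ::
  "('s \<Rightarrow> 't \<Rightarrow> 'w) \<Rightarrow> ('s \<Rightarrow>\<^sub>0 int) \<Rightarrow> ('t \<Rightarrow>\<^sub>0 int) \<Rightarrow> ('w \<Rightarrow>\<^sub>0 int)" where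
  "frag_extend2 \<beta> f g = frag_extend (\<lambda>s. frag_extend (\<lambda>t. frag_of (\<beta> s t)) g) f"

definition ring_as_module :: "'k ring \<Rightarrow> ('r \<Rightarrow> 'k) \<Rightarrow> ('r, 'k) module" where
  "ring_as_module K \<iota> =
     \<lparr>carrier = carrier K, monoid.mult = monoid.mult K, one = one K,
      ring.zero = ring.zero K, add = add K,
      module.smult = (\<lambda>r x. \<iota> r \<otimes>\<^bsub>K\<^esub> x)\<rparr>"

text \<open>
  The \<open>K\<close>-algebra \<open>K \<otimes> A\<close> over \<open>R\<close>, with \<open>(x \<otimes> a) (y \<otimes> b) = xy \<otimes> ab\<close> and
  \<open>c (x \<otimes> a) = cx \<otimes> a\<close>. As in \<^const>\<open>rcoset_mult\<close>, operations on cosets are unions over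
  representatives; all of these give the same coset.
\<close>

definition extend_algebra ::
  "'r ring \<Rightarrow> 'k ring \<Rightarrow> ('r \<Rightarrow> 'k) \<Rightarrow> ('r, 'a) module \<Rightarrow> ('k, ('k, 'a) tensor) module" where
  "extend_algebra R K \<iota> A =
     (let T = tensor_product R (ring_as_module K \<iota>) A;
          cls = tensor_class R (ring_as_module K \<iota>) A
      in \<lparr>carrier = carrier T,
          monoid.mult = (\<lambda>C D. \<Union>f\<in>C. \<Union>g\<in>D.
                    cls (frag_extend2 (\<lambda>(x, a) (y, b). (x \<otimes>\<^bsub>K\<^esub> y, a \<otimes>\<^bsub>A\<^esub> b)) f g)),
          one = cls (frag_of (\<one>\<^bsub>K\<^esub>, \<one>\<^bsub>A\<^esub>)),
          ring.zero = one T, add = monoid.mult T,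
          module.smult = (\<lambda>c C. \<Union>f\<in>C. cls (frag_extend (\<lambda>(x, a). frag_of (c \<otimes>\<^bsub>K\<^esub> x, a)) f))\<rparr>)"

text \<open>The \<open>K \<otimes> A\<close>-module \<open>K \<otimes> U\<close>, with \<open>(x \<otimes> a) (y \<otimes> u) = xy \<otimes> au\<close>.\<close>

definition extend_module ::
  "'r ring \<Rightarrow> 'k ring \<Rightarrow> ('r \<Rightarrow> 'k) \<Rightarrow> ('r, 'a) module \<Rightarrow> ('a, 'u) module \<Rightarrow>
     (('k, 'a) tensor, ('k, 'u) tensor) module" where
  "extend_module R K \<iota> A U =
     (let T = tensor_product R (ring_as_module K \<iota>) (restrict_scalars A U);
          cls = tensor_class R (ring_as_module K \<iota>) (restrict_scalars A U)
      in \<lparr>carrier = carrier T, monoid.mult = undefined, one = undefined,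
          ring.zero = one T, add = monoid.mult T,
          module.smult = (\<lambda>C D. \<Union>f\<in>C. \<Union>g\<in>D.
                     cls (frag_extend2 (\<lambda>(x, a) (y, u). (x \<otimes>\<^bsub>K\<^esub> y, a \<odot>\<^bsub>U\<^esub> u)) f g))\<rparr>)"


section \<open>Split semisimple algebras\<close>

definition regular_module :: "'b ring \<Rightarrow> ('b, 'b) module" where
  "regular_module B =
     \<lparr>carrier = carrier B, monoid.mult = monoid.mult B, one = one B,
      ring.zero = ring.zero B, add = add B,
      module.smult = monoid.mult B\<rparr>"

text \<open>
  Split means that every endomorphism of a simple module is multiplication by a scalar of \<open>K\<close>.
  Every simple \<open>B\<close>-module is isomorphic to a quotient of the regular module, whose elements are sets
  of elements of \<open>B\<close>, so it suffices to let \<open>S\<close> range over modules of that type.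
\<close>

definition split_semisimple_algebra :: "'k ring \<Rightarrow> ('k, 'b) module \<Rightarrow> bool" where
  "split_semisimple_algebra K B \<longleftrightarrow>
     assoc_algebra K B \<and> free_of_finite_rank K B \<and>
     semisimple_module (underlying_ring B) (regular_module (underlying_ring B)) \<and>
     (\<forall>S :: ('b, 'b set) module. simple_module (underlying_ring B) S \<longrightarrow>
        (\<forall>\<phi>\<in>module_homs (underlying_ring B) S S.
           \<exists>c\<in>carrier K. \<forall>v\<in>carrier S. \<phi> v = (c \<odot>\<^bsub>B\<^esub> \<one>\<^bsub>B\<^esub>) \<odot>\<^bsub>S\<^esub> v))"

end

theory Submission
  imports Defs
begin

text \<open>
  Let \<open>x\<close> run over a basis \<open>E\<close> of \<open>A\<close> with dual basis \<open>d x\<close> for the symmetrising form \<open>s\<close>, and let the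
  relative projective element be \<open>\<Sum> x d(x) = l\<close>, a scalar. For an \<open>R\<close>-linear endomorphism \<open>\<psi>\<close> of
  \<open>U\<close> the relative trace \<open>u \<mapsto> \<Sum> d(x) \<psi>(x u)\<close> is \<open>A\<close>-linear. On a rank one map \<open>u \<mapsto> f(u) w\<close> its value
  has linear trace \<open>\<Sum> f(x d(x) w) = l f(w)\<close>; this is where the projective scalar property enters.

  Projectivity provides \<open>A\<close>-linear maps \<open>\<phi>\<^sub>i\<close> from \<open>U\<close> to \<open>A\<close> and \<open>m\<^sub>i\<close> in \<open>U\<close> with \<open>u = \<Sum> \<phi>\<^sub>i(u) m\<^sub>i\<close>. Since
  \<open>a = \<Sum> s(x a) d(x)\<close> in \<open>A\<close>, this says that the identity of \<open>U\<close> is a sum of relative traces of rank one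
  maps. Taking linear traces, \<open>l\<close> divides the rank of \<open>U\<close>. Conversely, let \<open>f(w) = 1\<close>. The relative
  trace of \<open>u \<mapsto> f(u) w\<close> is an endomorphism of \<open>U\<close> of trace \<open>l\<close>, so the first half of the Knoerr condition
  shows that the rank divides \<open>l\<close>. Hence \<open>l\<close> and the rank generate the same ideal, and the second half
  of the Knoerr condition makes that endomorphism an automorphism. Its image lies in \<open>A w\<close>, so \<open>U = A w\<close>
  for every unimodular \<open>w\<close>, that is, for every \<open>w\<close> that some linear form sends to \<open>1\<close>
  (\<open>unimodular_generates\<close>).

  Over a principal ideal domain every nonzero \<open>u\<close> in \<open>U\<close> is \<open>g w\<close> with \<open>w\<close> unimodular
  (\<open>unimodular_factor\<close>). If \<open>u\<close> is not in \<open>\<pi> U\<close> then \<open>g\<close> is not in the maximal ideal generated by \<open>\<pi>\<close>, so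
  \<open>A u + \<pi> U = g U + \<pi> U = U\<close>, and \<open>U / \<pi> U\<close> is simple. Over \<open>K\<close> the factor \<open>g\<close> is invertible. Every element
  of \<open>K \<otimes> U\<close> is a pure tensor, by clearing denominators, so every nonzero element generates \<open>K \<otimes> U\<close>.
\<close>

section \<open>Finite sums\<close>

lemma additive_finsum:
  assumes M: "abelian_group M" and N: "abelian_group N"
    and f: "f \<in> carrier M \<rightarrow> carrier N"
    and add: "\<And>x y. x \<in> carrier M \<Longrightarrow> y \<in> carrier M \<Longrightarrow> f (x \<oplus>\<^bsub>M\<^esub> y) = f x \<oplus>\<^bsub>N\<^esub> f y"
    and S: "finite S" "g \<in> S \<rightarrow> carrier M"
  shows "f (\<Oplus>\<^bsub>M\<^esub>i\<in>S. g i) = (\<Oplus>\<^bsub>N\<^esub>i\<in>S. f (g i))"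
proof -
  interpret M: abelian_group M by (fact M)
  interpret N: abelian_group N by (fact N)
  have f0: "f \<zero>\<^bsub>M\<^esub> = \<zero>\<^bsub>N\<^esub>"
  proof -
    have "f \<zero>\<^bsub>M\<^esub> \<oplus>\<^bsub>N\<^esub> f \<zero>\<^bsub>M\<^esub> = f \<zero>\<^bsub>M\<^esub>" using add[of "\<zero>\<^bsub>M\<^esub>" "\<zero>\<^bsub>M\<^esub>"] by simp
    thus ?thesis using f by (metis M.zero_closed N.add.r_cancel_one' PiE)
  qed
  show ?thesis using S
    by (induction S rule: finite_induct)
      (use f in \<open>auto simp: f0 add M.finsum_insert N.finsum_insert Pi_iff M.finsum_closed\<close>)
qed

lemma (in abelian_monoid) finsum_swap:
  assumes "finite I" "finite J" "\<And>i j. i \<in> I \<Longrightarrow> j \<in> J \<Longrightarrow> f i j \<in> carrier G"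
  shows "(\<Oplus>i\<in>I. \<Oplus>j\<in>J. f i j) = (\<Oplus>j\<in>J. \<Oplus>i\<in>I. f i j)"
  using assms(1,3)
proof (induction I rule: finite_induct)
  case empty
  then show ?case by simp
next
  case (insert i I)
  then have "(\<Oplus>k\<in>insert i I. \<Oplus>j\<in>J. f k j) = (\<Oplus>j\<in>J. f i j) \<oplus> (\<Oplus>j\<in>J. \<Oplus>k\<in>I. f k j)"
    by (simp add: finsum_insert Pi_iff finsum_closed)
  also have "\<dots> = (\<Oplus>j\<in>J. f i j \<oplus> (\<Oplus>k\<in>I. f k j))"
    using insert by (intro finsum_addf[symmetric]) (auto simp: Pi_iff)
  also have "\<dots> = (\<Oplus>j\<in>J. \<Oplus>k\<in>insert i I. f k j)"
    using insert by (intro finsum_cong') (auto simp: Pi_iff)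
  finally show ?case .
qed

section \<open>Coordinates and traces on finite free modules\<close>

lemma regular_module_simps [simp]:
  "carrier (regular_module B) = carrier B"
  "monoid.mult (regular_module B) = monoid.mult B"
  "one (regular_module B) = one B"
  "ring.zero (regular_module B) = ring.zero B"
  "add (regular_module B) = add B"
  "module.smult (regular_module B) = monoid.mult B"
  by (simp_all add: regular_module_def)

text \<open>
  For a noncommutative \<open>R\<close> these are the homomorphisms of left modules from \<open>M\<close> to the regular module, so the
  same notion serves for the dual basis lemma over \<open>A\<close>.
\<close>

abbreviation functionals :: "'r ring \<Rightarrow> ('r, 'b) module \<Rightarrow> ('b \<Rightarrow> 'r) set" where
  "functionals R M \<equiv> module_homs R M (regular_module R)"

locale finite_free_module = module R M
  for R :: "'r ring" (structure) and M :: "('r, 'b) module" (structure) +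
  assumes free: "free_of_finite_rank R M"
begin

abbreviation B where "B \<equiv> chosen_basis R M"
abbreviation coord where "coord b u \<equiv> coordinates R M B u b"

lemma basis: "finite_basis R M B"
  using free unfolding free_of_finite_rank_def chosen_basis_def by (rule someI_ex)

lemma finite_B: "finite B" and B_carrier: "b \<in> B \<Longrightarrow> b \<in> carrier M"
  using basis by (auto simp: finite_basis_def)

lemma coordinates_spec:
  assumes "u \<in> carrier M"
  shows "coordinates R M B u \<in> B \<rightarrow>\<^sub>E carrier R \<and> u = (\<Oplus>\<^bsub>M\<^esub>b\<in>B. coord b u \<odot>\<^bsub>M\<^esub> b)"
proof -
  have "\<exists>!c. c \<in> B \<rightarrow>\<^sub>E carrier R \<and> u = (\<Oplus>\<^bsub>M\<^esub>b\<in>B. c b \<odot>\<^bsub>M\<^esub> b)"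
    using basis assms by (auto simp: finite_basis_def)
  from theI'[OF this] show ?thesis unfolding coordinates_def by simp
qed

lemma coord_closed: "u \<in> carrier M \<Longrightarrow> b \<in> B \<Longrightarrow> coord b u \<in> carrier R"
  using coordinates_spec by blast

lemma expansion: "u \<in> carrier M \<Longrightarrow> (\<Oplus>\<^bsub>M\<^esub>b\<in>B. coord b u \<odot>\<^bsub>M\<^esub> b) = u"
  using coordinates_spec by metis

lemma coord_unique:
  assumes c: "c \<in> B \<rightarrow> carrier R" and u: "u = (\<Oplus>\<^bsub>M\<^esub>b\<in>B. c b \<odot>\<^bsub>M\<^esub> b)" and b: "b \<in> B"
  shows "coord b u = c b"
proof -
  have uc: "u \<in> carrier M" unfolding u
    using c B_carrier by (intro M.finsum_closed) (auto simp: Pi_iff)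
  then have ex: "\<exists>!c. c \<in> B \<rightarrow>\<^sub>E carrier R \<and> u = (\<Oplus>\<^bsub>M\<^esub>b\<in>B. c b \<odot>\<^bsub>M\<^esub> b)"
    using basis by (auto simp: finite_basis_def)
  have "u = (\<Oplus>\<^bsub>M\<^esub>b\<in>B. restrict c B b \<odot>\<^bsub>M\<^esub> b)"
    unfolding u using c B_carrier by (intro M.finsum_cong') (auto simp: Pi_iff)
  moreover have "restrict c B \<in> B \<rightarrow>\<^sub>E carrier R" using c by auto
  ultimately have "restrict c B = coordinates R M B u"
    using ex coordinates_spec[OF uc] by blast
  then have "coordinates R M B u b = restrict c B b" by simp
  then show ?thesis using b by simp
qed

lemma coord_functional: 
  assumes b: "b \<in> B"
  shows "coord b \<in> functionals R M"
proof -
  have "coord b (x \<oplus>\<^bsub>M\<^esub> y) = coord b x \<oplus> coord b y" if xy: "x \<in> carrier M" "y \<in> carrier M" for x y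
  proof (rule coord_unique[OF _ _ b])
    show "(\<lambda>b. coord b x \<oplus> coord b y) \<in> B \<rightarrow> carrier R"
      using xy coord_closed by auto
    have "x \<oplus>\<^bsub>M\<^esub> y = (\<Oplus>\<^bsub>M\<^esub>b\<in>B. coord b x \<odot>\<^bsub>M\<^esub> b) \<oplus>\<^bsub>M\<^esub> (\<Oplus>\<^bsub>M\<^esub>b\<in>B. coord b y \<odot>\<^bsub>M\<^esub> b)"
      using xy by (simp add: expansion)
    also have "\<dots> = (\<Oplus>\<^bsub>M\<^esub>b\<in>B. coord b x \<odot>\<^bsub>M\<^esub> b \<oplus>\<^bsub>M\<^esub> coord b y \<odot>\<^bsub>M\<^esub> b)"
      using xy coord_closed B_carrier by (intro M.finsum_addf[symmetric]) auto
    also have "\<dots> = (\<Oplus>\<^bsub>M\<^esub>b\<in>B. (coord b x \<oplus> coord b y) \<odot>\<^bsub>M\<^esub> b)"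
      using xy coord_closed B_carrier by (intro M.finsum_cong') (auto simp: smult_l_distr)
    finally show "x \<oplus>\<^bsub>M\<^esub> y = \<dots>" .
  qed
  moreover have "coord b (r \<odot>\<^bsub>M\<^esub> x) = r \<otimes> coord b x" if xy: "r \<in> carrier R" "x \<in> carrier M" for r x
  proof (rule coord_unique[OF _ _ b])
    show "(\<lambda>b. r \<otimes> coord b x) \<in> B \<rightarrow> carrier R"
      using xy coord_closed by auto
    have "r \<odot>\<^bsub>M\<^esub> x = r \<odot>\<^bsub>M\<^esub> (\<Oplus>\<^bsub>M\<^esub>b\<in>B. coord b x \<odot>\<^bsub>M\<^esub> b)"
      using xy by (simp add: expansion)
    also have "\<dots> = (\<Oplus>\<^bsub>M\<^esub>b\<in>B. r \<odot>\<^bsub>M\<^esub> (coord b x \<odot>\<^bsub>M\<^esub> b))"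
      using xy coord_closed B_carrier finite_B by (intro finsum_smult_ldistr) auto
    also have "\<dots> = (\<Oplus>\<^bsub>M\<^esub>b\<in>B. (r \<otimes> coord b x) \<odot>\<^bsub>M\<^esub> b)"
      using xy coord_closed B_carrier by (intro M.finsum_cong') (auto simp: smult_assoc1)
    finally show "r \<odot>\<^bsub>M\<^esub> x = \<dots>" .
  qed
  ultimately show ?thesis using coord_closed b by (auto simp: module_homs_def)
qed

lemma coord_basis: 
  assumes "b \<in> B" "b' \<in> B" 
  shows "coord b b' = (if b = b' then \<one> else \<zero>)"
proof (rule coord_unique[OF _ _ assms(1)])
  show "(\<lambda>b. if b = b' then \<one> else \<zero>) \<in> B \<rightarrow> carrier R" by auto
  have "(\<Oplus>\<^bsub>M\<^esub>b\<in>B. (if b = b' then \<one> else \<zero>) \<odot>\<^bsub>M\<^esub> b) = (\<Oplus>\<^bsub>M\<^esub>b\<in>B. if b' = b then b else \<zero>\<^bsub>M\<^esub>)"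
    using B_carrier by (intro M.finsum_cong') auto
  also have "\<dots> = b'" using finite_B assms B_carrier
    by (intro M.finsum_singleton) auto
  finally show "b' = (\<Oplus>\<^bsub>M\<^esub>b\<in>B. (if b = b' then \<one> else \<zero>) \<odot>\<^bsub>M\<^esub> b)" by simp
qed

lemma functionalD:
  assumes "f \<in> functionals R M"
  shows "f \<in> carrier M \<rightarrow> carrier R"
    and "\<And>x. x \<in> carrier M \<Longrightarrow> f x \<in> carrier R"
    and "\<And>x y. x \<in> carrier M \<Longrightarrow> y \<in> carrier M \<Longrightarrow> f (x \<oplus>\<^bsub>M\<^esub> y) = f x \<oplus> f y"
    and "\<And>r x. r \<in> carrier R \<Longrightarrow> x \<in> carrier M \<Longrightarrow> f (r \<odot>\<^bsub>M\<^esub> x) = r \<otimes> f x"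
  using assms by (auto simp: module_homs_def)

lemma functional_finsum:
  assumes f: "f \<in> functionals R M" and "finite S" "g \<in> S \<rightarrow> carrier M"
  shows "f (\<Oplus>\<^bsub>M\<^esub>i\<in>S. g i) = (\<Oplus>i\<in>S. f (g i))"
  by (rule additive_finsum[OF M.abelian_group_axioms R.abelian_group_axioms])
    (use assms functionalD[OF f] in auto)

lemma linear_trace_cong:
  assumes "\<And>b. b \<in> B \<Longrightarrow> \<alpha> b = \<beta> b" "\<beta> \<in> carrier M \<rightarrow> carrier M"
  shows "linear_trace R M \<alpha> = linear_trace R M \<beta>"
  unfolding linear_trace_def using assms B_carrier coord_closed
  by (intro R.finsum_cong') (auto simp: Pi_iff)

lemma linear_trace_finsum:
  assumes "finite J" "\<And>j. j \<in> J \<Longrightarrow> \<alpha> j \<in> carrier M \<rightarrow> carrier M"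
  shows "linear_trace R M (\<lambda>u. \<Oplus>\<^bsub>M\<^esub>j\<in>J. \<alpha> j u) = (\<Oplus>j\<in>J. linear_trace R M (\<alpha> j))"
proof -
  have *: "\<alpha> j b \<in> carrier M" if "j \<in> J" "b \<in> B" for j b
    using assms(2)[OF that(1)] B_carrier[OF that(2)] by blast
  have "linear_trace R M (\<lambda>u. \<Oplus>\<^bsub>M\<^esub>j\<in>J. \<alpha> j u) = (\<Oplus>b\<in>B. \<Oplus>j\<in>J. coord b (\<alpha> j b))"
    unfolding linear_trace_def
    by (rule R.finsum_cong')
      (use assms B_carrier coord_closed * in \<open>auto intro!: functional_finsum coord_functional R.finsum_closed\<close>)
  also have "\<dots> = (\<Oplus>j\<in>J. \<Oplus>b\<in>B. coord b (\<alpha> j b))"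
    by (rule R.finsum_swap) (use assms finite_B * coord_closed in auto)
  finally show ?thesis unfolding linear_trace_def .
qed

text \<open>
  Both sides are \<open>\<Sum> v\<^sub>b f(b)\<close>, where \<open>v\<^sub>b\<close> are the coordinates of \<open>v\<close>.
\<close>

lemma linear_trace_rank_one:
  assumes f: "f \<in> functionals R M" and v: "v \<in> carrier M"
  shows "linear_trace R M (\<lambda>u. f u \<odot>\<^bsub>M\<^esub> v) = f v"
proof -
  note fD = functionalD[OF f]
  have "linear_trace R M (\<lambda>u. f u \<odot>\<^bsub>M\<^esub> v) = (\<Oplus>b\<in>B. coord b v \<otimes> f b)"
    unfolding linear_trace_def using fD v B_carrier coord_closed
    by (intro R.finsum_cong') (auto simp: functionalD[OF coord_functional] R.m_comm)
  also have "\<dots> = (\<Oplus>b\<in>B. f (coord b v \<odot>\<^bsub>M\<^esub> b))"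
    using fD v B_carrier coord_closed by (intro R.finsum_cong') auto
  also have "\<dots> = f v"
    using functional_finsum[OF f finite_B, of "\<lambda>b. coord b v \<odot>\<^bsub>M\<^esub> b"] v B_carrier coord_closed
    by (auto simp: expansion)
  finally show ?thesis .
qed

lemma linear_trace_id: "linear_trace R M (\<lambda>u. u) = [free_rank R M] \<cdot> \<one>"
proof -
  have "linear_trace R M (\<lambda>u. u) = (\<Oplus>b\<in>B. \<one>)"
    unfolding linear_trace_def by (intro R.finsum_cong') (auto simp: coord_basis)
  also have "\<dots> = [free_rank R M] \<cdot> \<one>"
    unfolding free_rank_def by (rule R.add.finprod_const) simp
  finally show ?thesis .
qed

text \<open>
  The values at \<open>u\<close> of all linear forms make up an ideal. Its generator \<open>g\<close> is itself a value \<open>f(u)\<close> and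
  divides every coordinate of \<open>u\<close>, so \<open>u = g w\<close>; then \<open>g f(w) = g\<close>, and \<open>g\<close> can be cancelled.
\<close>

lemma unimodular_factor:
  assumes P: "principal_domain R" and u: "u \<in> carrier M" "u \<noteq> \<zero>\<^bsub>M\<^esub>"
  obtains g w f where "g \<in> carrier R" "g \<noteq> \<zero>" "w \<in> carrier M" "f \<in> functionals R M" "f w = \<one>" "u = g \<odot>\<^bsub>M\<^esub> w"
proof -
  interpret P: principal_domain R by (fact P)
  let ?I = "{f u | f. f \<in> functionals R M}"
  have lin: "(\<lambda>v. a \<otimes> f v \<oplus> b \<otimes> g v) \<in> functionals R M"
    if "a \<in> carrier R" "b \<in> carrier R" "f \<in> functionals R M" "g \<in> functionals R M" for a b f g
    using that functionalD[OF that(3)] functionalD[OF that(4)]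
    by (auto simp: module_homs_def R.r_distr R.m_lcomm R.a_ac)
  have "ideal ?I R"
  proof (rule idealI)
    show "ring R" by (rule R.ring_axioms)
    show "subgroup ?I (add_monoid R)"
    proof (rule R.add.subgroupI)
      show "?I \<subseteq> carrier R" using functionalD u by auto
      have "(\<lambda>_. \<zero>) \<in> functionals R M" by (auto simp: module_homs_def)
      then show "?I \<noteq> {}" by auto
      fix a assume "a \<in> ?I"
      then obtain f where f: "f \<in> functionals R M" "a = f u" by auto
      have "\<ominus> a = \<ominus> \<one> \<otimes> f u \<oplus> \<zero> \<otimes> f u"
        using functionalD[OF f(1)] u f(2) by (simp add: R.l_minus)
      then show "\<ominus> a \<in> ?I" using lin[OF _ _ f(1) f(1), of "\<ominus> \<one>" \<zero>] by (auto intro!: exI)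
    next
      fix a b assume "a \<in> ?I" "b \<in> ?I"
      then obtain f g where f: "f \<in> functionals R M" "a = f u" "g \<in> functionals R M" "b = g u" by auto
      have "a \<oplus> b = \<one> \<otimes> f u \<oplus> \<one> \<otimes> g u" using functionalD f u by simp
      then show "a \<oplus> b \<in> ?I" using lin[OF _ _ f(1) f(3), of \<one> \<one>] by (auto intro!: exI)
    qed
    fix a x assume "a \<in> ?I" and x: "x \<in> carrier R"
    then obtain f where f: "f \<in> functionals R M" "a = f u" by auto
    have "x \<otimes> a = x \<otimes> f u \<oplus> \<zero> \<otimes> f u"
      using functionalD[OF f(1)] u f(2) x by simp
    then show "x \<otimes> a \<in> ?I" using lin[OF _ _ f(1) f(1), of x \<zero>] x by (auto intro!: exI)
    then show "a \<otimes> x \<in> ?I" using R.m_comm[OF x] functionalD(2)[OF f(1) u(1)] f(2) by simp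
  qed
  then obtain g where g: "g \<in> carrier R" "?I = PIdl g"
    using P.exists_gen by blast
  have co: "\<exists>c\<in>carrier R. coord b u = c \<otimes> g" if "b \<in> B" for b
  proof -
    have "coord b u \<in> ?I" using coord_functional[OF that] by auto
    then show ?thesis unfolding g(2) by (auto simp: cgenideal_def)
  qed
  then obtain c where c: "\<And>b. b \<in> B \<Longrightarrow> c b \<in> carrier R" "\<And>b. b \<in> B \<Longrightarrow> coord b u = c b \<otimes> g" by (metis (no_types))
  define w where "w = (\<Oplus>\<^bsub>M\<^esub>b\<in>B. c b \<odot>\<^bsub>M\<^esub> b)"
  have w: "w \<in> carrier M" unfolding w_def using c B_carrier by (intro M.finsum_closed) auto
  have "u = (\<Oplus>\<^bsub>M\<^esub>b\<in>B. coord b u \<odot>\<^bsub>M\<^esub> b)" using u by (simp add: expansion)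
  also have "\<dots> = (\<Oplus>\<^bsub>M\<^esub>b\<in>B. g \<odot>\<^bsub>M\<^esub> (c b \<odot>\<^bsub>M\<^esub> b))"
    using c B_carrier g(1) by (intro M.finsum_cong') (auto simp: smult_assoc1[symmetric] R.m_comm)
  also have "\<dots> = g \<odot>\<^bsub>M\<^esub> w" unfolding w_def
    using c B_carrier g(1) finite_B by (intro finsum_smult_ldistr[symmetric]) auto
  finally have uw: "u = g \<odot>\<^bsub>M\<^esub> w" .
  have g0: "g \<noteq> \<zero>" using uw w u(2) by auto
  have "g \<in> ?I" using g R.cgenideal_self by simp
  then obtain f where f: "f \<in> functionals R M" "g = f u" by auto
  note fD = functionalD[OF f(1)]
  have "g \<otimes> f w = g \<otimes> \<one>" using f(2) uw fD w g(1) by simp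
  \<comment> \<open>This needs \<open>g \<noteq> 0\<close>, which is where \<open>u \<noteq> 0\<close> is used.\<close>
  then have "f w = \<one>" using P.m_lcancel[OF g0 g(1) fD(2)[OF w], of \<one>] by simp
  from that[OF g(1) g0 w f(1) this uw] show ?thesis .
qed

end

section \<open>Lattices over an algebra\<close>

lemma underlying_ring_simps [simp]:
  "carrier (underlying_ring A) = carrier A"
  "monoid.mult (underlying_ring A) = monoid.mult A"
  "one (underlying_ring A) = one A"
  "ring.zero (underlying_ring A) = ring.zero A"
  "add (underlying_ring A) = add A"
  by (simp_all add: underlying_ring_def)

lemma restrict_scalars_simps [simp]:
  "carrier (restrict_scalars A U) = carrier U"
  "ring.zero (restrict_scalars A U) = ring.zero U"
  "add (restrict_scalars A U) = add U"
  "finsum (restrict_scalars A U) = finsum U"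
  by (simp_all add: restrict_scalars_def finsum_def finprod_def fun_eq_iff)

lemma finite_basis_expansion:
  assumes "finite_basis R M B" "x \<in> carrier M"
  obtains c where "c \<in> B \<rightarrow>\<^sub>E carrier R" "x = (\<Oplus>\<^bsub>M\<^esub>b\<in>B. c b \<odot>\<^bsub>M\<^esub> b)"
proof -
  have "\<exists>!c. c \<in> B \<rightarrow>\<^sub>E carrier R \<and> x = (\<Oplus>\<^bsub>M\<^esub>b\<in>B. c b \<odot>\<^bsub>M\<^esub> b)"
    using assms by (simp add: finite_basis_def)
  from ex1_implies_ex[OF this] that show ?thesis by (elim exE conjE)
qed

locale algebra_lattice = A: assoc_algebra R A + U: left_module "underlying_ring A" U
  for R :: "'r ring" and A :: "('r, 'a) module" and U :: "('a, 'u) module" +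
  assumes lattice_free: "free_of_finite_rank R (restrict_scalars A U)"
begin

abbreviation V where "V \<equiv> restrict_scalars A U"

lemma act_closed [simp, intro]: "a \<in> carrier A \<Longrightarrow> u \<in> carrier U \<Longrightarrow> a \<odot>\<^bsub>U\<^esub> u \<in> carrier U"
  and act_add_left: "a \<in> carrier A \<Longrightarrow> b \<in> carrier A \<Longrightarrow> u \<in> carrier U \<Longrightarrow>
        (a \<oplus>\<^bsub>A\<^esub> b) \<odot>\<^bsub>U\<^esub> u = a \<odot>\<^bsub>U\<^esub> u \<oplus>\<^bsub>U\<^esub> b \<odot>\<^bsub>U\<^esub> u"
  and act_add_right: "a \<in> carrier A \<Longrightarrow> u \<in> carrier U \<Longrightarrow> v \<in> carrier U \<Longrightarrow>
        a \<odot>\<^bsub>U\<^esub> (u \<oplus>\<^bsub>U\<^esub> v) = a \<odot>\<^bsub>U\<^esub> u \<oplus>\<^bsub>U\<^esub> a \<odot>\<^bsub>U\<^esub> v"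
  and act_assoc: "a \<in> carrier A \<Longrightarrow> b \<in> carrier A \<Longrightarrow> u \<in> carrier U \<Longrightarrow>
        (a \<otimes>\<^bsub>A\<^esub> b) \<odot>\<^bsub>U\<^esub> u = a \<odot>\<^bsub>U\<^esub> (b \<odot>\<^bsub>U\<^esub> u)"
  and act_one [simp]: "u \<in> carrier U \<Longrightarrow> \<one>\<^bsub>A\<^esub> \<odot>\<^bsub>U\<^esub> u = u"
  using U.smult_closed U.smult_l_distr U.smult_r_distr U.smult_assoc U.smult_unital by simp_all

lemma V_smult: "r \<odot>\<^bsub>V\<^esub> u = (r \<odot>\<^bsub>A\<^esub> \<one>\<^bsub>A\<^esub>) \<odot>\<^bsub>U\<^esub> u"
  by (simp add: restrict_scalars_def)

lemma act_smult_left: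
  "r \<in> carrier R \<Longrightarrow> a \<in> carrier A \<Longrightarrow> u \<in> carrier U \<Longrightarrow> (r \<odot>\<^bsub>A\<^esub> a) \<odot>\<^bsub>U\<^esub> u = r \<odot>\<^bsub>V\<^esub> (a \<odot>\<^bsub>U\<^esub> u)"
  unfolding V_smult by (simp add: act_assoc[symmetric] A.smult_mult_left)

lemma act_smult_right:
  "r \<in> carrier R \<Longrightarrow> a \<in> carrier A \<Longrightarrow> u \<in> carrier U \<Longrightarrow> a \<odot>\<^bsub>U\<^esub> (r \<odot>\<^bsub>V\<^esub> u) = r \<odot>\<^bsub>V\<^esub> (a \<odot>\<^bsub>U\<^esub> u)"
  unfolding V_smult by (simp add: act_assoc[symmetric] A.smult_mult_left A.smult_mult_right)

lemma V_abelian_group: "abelian_group V"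
proof (rule abelian_groupI)
  fix u assume "u \<in> carrier V"
  then show "\<exists>v\<in>carrier V. v \<oplus>\<^bsub>V\<^esub> u = \<zero>\<^bsub>V\<^esub>"
    by (auto intro!: bexI[of _ "\<ominus>\<^bsub>U\<^esub> u"] U.M.l_neg)
qed (auto simp: U.M.a_ac)

lemma V_module: "module R V"
proof (rule moduleI[OF A.R.cring_axioms V_abelian_group])
qed (auto simp: V_smult A.smult_l_distr A.smult_r_distr act_add_left act_add_right act_assoc[symmetric]
      A.smult_assoc1 A.smult_mult_left)

sublocale V: finite_free_module R V
  by (rule finite_free_module.intro[OF V_module]) (unfold_locales, fact lattice_free)

lemma act_finsum_left:
  assumes "finite S" "a \<in> S \<rightarrow> carrier A" "u \<in> carrier U"
  shows "(\<Oplus>\<^bsub>A\<^esub>i\<in>S. a i) \<odot>\<^bsub>U\<^esub> u = (\<Oplus>\<^bsub>U\<^esub>i\<in>S. a i \<odot>\<^bsub>U\<^esub> u)"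
  by (rule additive_finsum[where f = "\<lambda>a. a \<odot>\<^bsub>U\<^esub> u", OF A.M.abelian_group_axioms U.M.abelian_group_axioms])
    (use assms in \<open>auto simp: act_add_left\<close>)

lemma act_finsum_right:
  assumes "finite S" "u \<in> S \<rightarrow> carrier U" "a \<in> carrier A"
  shows "a \<odot>\<^bsub>U\<^esub> (\<Oplus>\<^bsub>U\<^esub>i\<in>S. u i) = (\<Oplus>\<^bsub>U\<^esub>i\<in>S. a \<odot>\<^bsub>U\<^esub> u i)"
  by (rule additive_finsum[OF U.M.abelian_group_axioms U.M.abelian_group_axioms])
    (use assms in \<open>auto simp: act_add_right\<close>)

lemma functional_act:
  assumes "f \<in> functionals R V" "a \<in> carrier A"
  shows "(\<lambda>u. f (a \<odot>\<^bsub>U\<^esub> u)) \<in> functionals R V"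
  using assms V.functionalD[OF assms(1)]
  by (auto simp: module_homs_def act_add_right act_smult_right)

end

section \<open>The relative trace of a symmetric algebra\<close>

locale dual_bases = algebra_lattice +
  fixes s E d
  assumes form: "s \<in> linear_forms R A" and E_basis: "finite_basis R A E"
    and dual: "dual_basis R A s E d"
begin

lemma finite_E [simp]: "finite E" and E_carrier [simp]: "x \<in> E \<Longrightarrow> x \<in> carrier A"
  using E_basis unfolding finite_basis_def by blast+

lemma d_carrier [simp]: "x \<in> E \<Longrightarrow> d x \<in> carrier A"
  using dual unfolding dual_basis_def finite_basis_def by blast

lemma d_inj: "inj_on d E" and s_dual: "x \<in> E \<Longrightarrow> y \<in> E \<Longrightarrow> s (x \<otimes>\<^bsub>A\<^esub> d y) = (if x = y then \<one>\<^bsub>R\<^esub> else \<zero>\<^bsub>R\<^esub>)"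
  using dual unfolding dual_basis_def by blast+

sublocale A_free: finite_free_module R A
  by unfold_locales (use E_basis in \<open>auto simp: free_of_finite_rank_def\<close>)

lemma s_functional: "s \<in> functionals R A"
  using form by (auto simp: linear_forms_def module_homs_def)

lemmas sD = A_free.functionalD[OF s_functional]

text \<open>
  The coefficient of \<open>c\<close> at \<open>d x\<close> is found by applying \<open>s(x _)\<close> to the expansion of \<open>c\<close> in the dual basis.
\<close>

lemma dual_expansion:
  assumes c: "c \<in> carrier A"
  shows "c = (\<Oplus>\<^bsub>A\<^esub>x\<in>E. s (x \<otimes>\<^bsub>A\<^esub> c) \<odot>\<^bsub>A\<^esub> d x)"
proof -
  obtain k where k: "k \<in> d ` E \<rightarrow>\<^sub>E carrier R" "c = (\<Oplus>\<^bsub>A\<^esub>b\<in>d ` E. k b \<odot>\<^bsub>A\<^esub> b)"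
    using dual finite_basis_expansion[OF _ c] unfolding dual_basis_def by metis
  have kc: "k (d x) \<in> carrier R" if "x \<in> E" for x using k(1) that by auto
  have ck: "c = (\<Oplus>\<^bsub>A\<^esub>x\<in>E. k (d x) \<odot>\<^bsub>A\<^esub> d x)"
    unfolding k(2) by (rule A.M.finsum_reindex) (use d_inj kc in auto)
  have "s (x \<otimes>\<^bsub>A\<^esub> c) = k (d x)" if x: "x \<in> E" for x
  proof -
    have "x \<otimes>\<^bsub>A\<^esub> c = (\<Oplus>\<^bsub>A\<^esub>y\<in>E. x \<otimes>\<^bsub>A\<^esub> (k (d y) \<odot>\<^bsub>A\<^esub> d y))"
      by (subst ck, rule A.A.finsum_rdistr) (use x kc in auto)
    then have "s (x \<otimes>\<^bsub>A\<^esub> c) = (\<Oplus>\<^bsub>R\<^esub>y\<in>E. s (x \<otimes>\<^bsub>A\<^esub> (k (d y) \<odot>\<^bsub>A\<^esub> d y)))"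
      by (simp only:) (rule A_free.functional_finsum[OF s_functional], use x kc in auto)
    also have "\<dots> = (\<Oplus>\<^bsub>R\<^esub>y\<in>E. if x = y then k (d y) else \<zero>\<^bsub>R\<^esub>)"
      using x kc by (intro A.R.finsum_cong') (auto simp: A.smult_mult_right sD(4) s_dual)
    also have "\<dots> = k (d x)" using x kc by (intro A.R.finsum_singleton) auto
    finally show ?thesis .
  qed
  then have "(\<Oplus>\<^bsub>A\<^esub>x\<in>E. s (x \<otimes>\<^bsub>A\<^esub> c) \<odot>\<^bsub>A\<^esub> d x) = (\<Oplus>\<^bsub>A\<^esub>x\<in>E. k (d x) \<odot>\<^bsub>A\<^esub> d x)"
    using kc by (intro A.M.finsum_cong') auto
  then show ?thesis using ck by simp
qed

lemma basis_expansion: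
  assumes c: "c \<in> carrier A"
  shows "c = (\<Oplus>\<^bsub>A\<^esub>y\<in>E. s (c \<otimes>\<^bsub>A\<^esub> d y) \<odot>\<^bsub>A\<^esub> y)"
proof -
  obtain k where k: "k \<in> E \<rightarrow>\<^sub>E carrier R" and ck: "c = (\<Oplus>\<^bsub>A\<^esub>b\<in>E. k b \<odot>\<^bsub>A\<^esub> b)"
    using finite_basis_expansion[OF E_basis c] .
  have kc: "k x \<in> carrier R" if "x \<in> E" for x using k(1) that by auto
  have "s (c \<otimes>\<^bsub>A\<^esub> d x) = k x" if x: "x \<in> E" for x
  proof -
    have "c \<otimes>\<^bsub>A\<^esub> d x = (\<Oplus>\<^bsub>A\<^esub>y\<in>E. (k y \<odot>\<^bsub>A\<^esub> y) \<otimes>\<^bsub>A\<^esub> d x)"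
      by (subst ck, rule A.A.finsum_ldistr) (use x kc in auto)
    then have "s (c \<otimes>\<^bsub>A\<^esub> d x) = (\<Oplus>\<^bsub>R\<^esub>y\<in>E. s ((k y \<odot>\<^bsub>A\<^esub> y) \<otimes>\<^bsub>A\<^esub> d x))"
      by (simp only:) (rule A_free.functional_finsum[OF s_functional], use x kc in auto)
    also have "\<dots> = (\<Oplus>\<^bsub>R\<^esub>y\<in>E. if x = y then k y else \<zero>\<^bsub>R\<^esub>)"
      using x kc by (intro A.R.finsum_cong') (auto simp: A.smult_mult_left sD(4) s_dual)
    also have "\<dots> = k x" using x kc by (intro A.R.finsum_singleton) auto
    finally show ?thesis .
  qed
  then have "(\<Oplus>\<^bsub>A\<^esub>x\<in>E. s (c \<otimes>\<^bsub>A\<^esub> d x) \<odot>\<^bsub>A\<^esub> x) = (\<Oplus>\<^bsub>A\<^esub>x\<in>E. k x \<odot>\<^bsub>A\<^esub> x)"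
    using kc by (intro A.M.finsum_cong') auto
  then show ?thesis using ck by simp
qed

text \<open>
  The dual basis acts on the left and the basis on the right. In this order the trace formula below involves
  \<open>\<Sum> x d(x)\<close>, the relative projective element itself, rather than \<open>\<Sum> d(x) x\<close>.
\<close>

definition relative_trace :: "('c \<Rightarrow> 'c) \<Rightarrow> 'c \<Rightarrow> 'c" where
  "relative_trace \<psi> u = (\<Oplus>\<^bsub>U\<^esub>x\<in>E. d x \<odot>\<^bsub>U\<^esub> \<psi> (x \<odot>\<^bsub>U\<^esub> u))"

text \<open>
  Expanding \<open>x a = \<Sum>\<^sub>y s(x a d(y)) y\<close> moves \<open>a\<close> across \<open>\<psi>\<close> as scalars, and
  \<open>\<Sum>\<^sub>x s(x a d(y)) d(x) = a d(y)\<close> collects them again on the other side.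
\<close>

lemma relative_trace_hom:
  assumes \<psi>: "\<psi> \<in> module_homs R V V"
  shows "relative_trace \<psi> \<in> module_homs (underlying_ring A) U U"
proof -
  have \<psi>c: "\<psi> u \<in> carrier U" if "u \<in> carrier U" for u using \<psi> that by (auto simp: module_homs_def)
  have \<psi>a: "\<psi> (u \<oplus>\<^bsub>U\<^esub> v) = \<psi> u \<oplus>\<^bsub>U\<^esub> \<psi> v" if "u \<in> carrier U" "v \<in> carrier U" for u v
    using \<psi> that by (auto simp: module_homs_def)
  have \<psi>s: "\<psi> (r \<odot>\<^bsub>V\<^esub> u) = r \<odot>\<^bsub>V\<^esub> \<psi> u" if "r \<in> carrier R" "u \<in> carrier U" for r u
    using \<psi> that by (auto simp: module_homs_def)
  have Vc: "r \<odot>\<^bsub>V\<^esub> u \<in> carrier U" if "r \<in> carrier R" "u \<in> carrier U" for r u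
    using V.smult_closed that by simp
  have 1: "relative_trace \<psi> (u \<oplus>\<^bsub>U\<^esub> v) = relative_trace \<psi> u \<oplus>\<^bsub>U\<^esub> relative_trace \<psi> v" if uv: "u \<in> carrier U" "v \<in> carrier U" for u v
  proof -
    have "relative_trace \<psi> (u \<oplus>\<^bsub>U\<^esub> v) = (\<Oplus>\<^bsub>U\<^esub>x\<in>E. d x \<odot>\<^bsub>U\<^esub> \<psi> (x \<odot>\<^bsub>U\<^esub> u) \<oplus>\<^bsub>U\<^esub> d x \<odot>\<^bsub>U\<^esub> \<psi> (x \<odot>\<^bsub>U\<^esub> v))"
      unfolding relative_trace_def using uv \<psi>c by (intro U.M.finsum_cong') (auto simp: act_add_right \<psi>a)
    also have "\<dots> = relative_trace \<psi> u \<oplus>\<^bsub>U\<^esub> relative_trace \<psi> v"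
      unfolding relative_trace_def using uv \<psi>c by (intro U.M.finsum_addf) auto
    finally show ?thesis .
  qed
  have 2: "relative_trace \<psi> (a \<odot>\<^bsub>U\<^esub> u) = a \<odot>\<^bsub>U\<^esub> relative_trace \<psi> u" if a: "a \<in> carrier A" and u: "u \<in> carrier U" for a u
  proof -
    let ?c = "\<lambda>x y. s (x \<otimes>\<^bsub>A\<^esub> a \<otimes>\<^bsub>A\<^esub> d y)"
    have cc: "?c x y \<in> carrier R" if "x \<in> E" "y \<in> E" for x y
      using that a sD(2) by simp
    have "\<psi> (x \<odot>\<^bsub>U\<^esub> (a \<odot>\<^bsub>U\<^esub> u)) = (\<Oplus>\<^bsub>U\<^esub>y\<in>E. ?c x y \<odot>\<^bsub>V\<^esub> \<psi> (y \<odot>\<^bsub>U\<^esub> u))" if x: "x \<in> E" for x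
    proof -
      have "x \<odot>\<^bsub>U\<^esub> (a \<odot>\<^bsub>U\<^esub> u) = (x \<otimes>\<^bsub>A\<^esub> a) \<odot>\<^bsub>U\<^esub> u" using x a u by (simp add: act_assoc)
      also have "\<dots> = (\<Oplus>\<^bsub>A\<^esub>y\<in>E. ?c x y \<odot>\<^bsub>A\<^esub> y) \<odot>\<^bsub>U\<^esub> u"
        using x a basis_expansion[of "x \<otimes>\<^bsub>A\<^esub> a"] by simp
      also have "\<dots> = (\<Oplus>\<^bsub>U\<^esub>y\<in>E. (?c x y \<odot>\<^bsub>A\<^esub> y) \<odot>\<^bsub>U\<^esub> u)"
        using x u cc by (intro act_finsum_left) auto
      also have "\<dots> = (\<Oplus>\<^bsub>U\<^esub>y\<in>E. ?c x y \<odot>\<^bsub>V\<^esub> (y \<odot>\<^bsub>U\<^esub> u))"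
        using x u cc Vc by (intro U.M.finsum_cong') (auto simp: act_smult_left)
      finally have "\<psi> (x \<odot>\<^bsub>U\<^esub> (a \<odot>\<^bsub>U\<^esub> u)) = \<psi> (\<Oplus>\<^bsub>U\<^esub>y\<in>E. ?c x y \<odot>\<^bsub>V\<^esub> (y \<odot>\<^bsub>U\<^esub> u))" by simp
      also have "\<dots> = (\<Oplus>\<^bsub>U\<^esub>y\<in>E. \<psi> (?c x y \<odot>\<^bsub>V\<^esub> (y \<odot>\<^bsub>U\<^esub> u)))"
        by (rule additive_finsum[OF U.M.abelian_group_axioms U.M.abelian_group_axioms])
          (use x u cc Vc \<psi>c \<psi>a in auto)
      also have "\<dots> = (\<Oplus>\<^bsub>U\<^esub>y\<in>E. ?c x y \<odot>\<^bsub>V\<^esub> \<psi> (y \<odot>\<^bsub>U\<^esub> u))"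
        using x u cc Vc \<psi>c by (intro U.M.finsum_cong') (auto simp: \<psi>s)
      finally show ?thesis .
    qed
    then have "relative_trace \<psi> (a \<odot>\<^bsub>U\<^esub> u) = (\<Oplus>\<^bsub>U\<^esub>x\<in>E. d x \<odot>\<^bsub>U\<^esub> (\<Oplus>\<^bsub>U\<^esub>y\<in>E. ?c x y \<odot>\<^bsub>V\<^esub> \<psi> (y \<odot>\<^bsub>U\<^esub> u)))"
      unfolding relative_trace_def using u cc Vc \<psi>c by (intro U.M.finsum_cong') (auto intro!: act_closed U.M.finsum_closed)
    also have "\<dots> = (\<Oplus>\<^bsub>U\<^esub>x\<in>E. \<Oplus>\<^bsub>U\<^esub>y\<in>E. (?c x y \<odot>\<^bsub>A\<^esub> d x) \<odot>\<^bsub>U\<^esub> \<psi> (y \<odot>\<^bsub>U\<^esub> u))"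
    proof (rule U.M.finsum_cong'[OF refl])
      fix x assume x: "x \<in> E"
      have "d x \<odot>\<^bsub>U\<^esub> (\<Oplus>\<^bsub>U\<^esub>y\<in>E. ?c x y \<odot>\<^bsub>V\<^esub> \<psi> (y \<odot>\<^bsub>U\<^esub> u)) = (\<Oplus>\<^bsub>U\<^esub>y\<in>E. d x \<odot>\<^bsub>U\<^esub> (?c x y \<odot>\<^bsub>V\<^esub> \<psi> (y \<odot>\<^bsub>U\<^esub> u)))"
        using x u cc Vc \<psi>c by (intro act_finsum_right) auto
      also have "\<dots> = (\<Oplus>\<^bsub>U\<^esub>y\<in>E. (?c x y \<odot>\<^bsub>A\<^esub> d x) \<odot>\<^bsub>U\<^esub> \<psi> (y \<odot>\<^bsub>U\<^esub> u))"
        using x u cc Vc \<psi>c by (intro U.M.finsum_cong') (auto simp: act_smult_left act_smult_right)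
      finally show "d x \<odot>\<^bsub>U\<^esub> (\<Oplus>\<^bsub>U\<^esub>y\<in>E. ?c x y \<odot>\<^bsub>V\<^esub> \<psi> (y \<odot>\<^bsub>U\<^esub> u)) = \<dots>" .
    qed (use u cc \<psi>c in \<open>auto intro!: U.M.finsum_closed act_closed\<close>)
    also have "\<dots> = (\<Oplus>\<^bsub>U\<^esub>y\<in>E. \<Oplus>\<^bsub>U\<^esub>x\<in>E. (?c x y \<odot>\<^bsub>A\<^esub> d x) \<odot>\<^bsub>U\<^esub> \<psi> (y \<odot>\<^bsub>U\<^esub> u))"
      by (rule U.M.finsum_swap) (use u cc \<psi>c in auto)
    also have "\<dots> = (\<Oplus>\<^bsub>U\<^esub>y\<in>E. a \<odot>\<^bsub>U\<^esub> (d y \<odot>\<^bsub>U\<^esub> \<psi> (y \<odot>\<^bsub>U\<^esub> u)))"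
    proof (rule U.M.finsum_cong'[OF refl])
      fix y assume y: "y \<in> E"
      have "(\<Oplus>\<^bsub>U\<^esub>x\<in>E. (?c x y \<odot>\<^bsub>A\<^esub> d x) \<odot>\<^bsub>U\<^esub> \<psi> (y \<odot>\<^bsub>U\<^esub> u)) = (\<Oplus>\<^bsub>A\<^esub>x\<in>E. ?c x y \<odot>\<^bsub>A\<^esub> d x) \<odot>\<^bsub>U\<^esub> \<psi> (y \<odot>\<^bsub>U\<^esub> u)"
        using y u cc \<psi>c by (intro act_finsum_left[symmetric]) auto
      also have "(\<Oplus>\<^bsub>A\<^esub>x\<in>E. ?c x y \<odot>\<^bsub>A\<^esub> d x) = (\<Oplus>\<^bsub>A\<^esub>x\<in>E. s (x \<otimes>\<^bsub>A\<^esub> (a \<otimes>\<^bsub>A\<^esub> d y)) \<odot>\<^bsub>A\<^esub> d x)"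
        using y a sD(2) by (intro A.M.finsum_cong') (auto simp: A.m_assoc)
      also have "\<dots> = a \<otimes>\<^bsub>A\<^esub> d y" using y a dual_expansion[of "a \<otimes>\<^bsub>A\<^esub> d y"] by simp
      finally show "(\<Oplus>\<^bsub>U\<^esub>x\<in>E. (?c x y \<odot>\<^bsub>A\<^esub> d x) \<odot>\<^bsub>U\<^esub> \<psi> (y \<odot>\<^bsub>U\<^esub> u)) = a \<odot>\<^bsub>U\<^esub> (d y \<odot>\<^bsub>U\<^esub> \<psi> (y \<odot>\<^bsub>U\<^esub> u))"
        using y a u \<psi>c by (simp add: act_assoc)
    qed (use a u \<psi>c in auto)
    also have "\<dots> = a \<odot>\<^bsub>U\<^esub> relative_trace \<psi> u"
      unfolding relative_trace_def using a u \<psi>c by (intro act_finsum_right[symmetric]) auto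
    finally show ?thesis .
  qed
  show ?thesis using 1 2 \<psi>c by (auto simp: module_homs_def relative_trace_def intro!: U.M.finsum_closed)
qed

abbreviation rank_one :: "('c \<Rightarrow> 'a) \<Rightarrow> 'c \<Rightarrow> 'c \<Rightarrow> 'c" where
  "rank_one f w \<equiv> (\<lambda>u. f u \<odot>\<^bsub>V\<^esub> w)"

lemma rank_one_hom:
  assumes "f \<in> functionals R V" "w \<in> carrier U"
  shows "rank_one f w \<in> module_homs R V V"
  using assms V.functionalD[OF assms(1)] V.smult_l_distr V.smult_assoc1 V.smult_closed
  by (auto simp: module_homs_def)

lemma relative_trace_rank_one:
  assumes f: "f \<in> functionals R V" and w: "w \<in> carrier U" and u: "u \<in> carrier U"
  shows "relative_trace (rank_one f w) u = (\<Oplus>\<^bsub>U\<^esub>x\<in>E. f (x \<odot>\<^bsub>U\<^esub> u) \<odot>\<^bsub>V\<^esub> (d x \<odot>\<^bsub>U\<^esub> w))"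
  unfolding relative_trace_def using V.functionalD[OF f] w u V.smult_closed
  by (intro U.M.finsum_cong') (auto simp: act_smult_right)

lemma relative_trace_rank_one_cyclic:
  assumes f: "f \<in> functionals R V" and w: "w \<in> carrier U" and u: "u \<in> carrier U"
  shows "\<exists>a\<in>carrier A. relative_trace (rank_one f w) u = a \<odot>\<^bsub>U\<^esub> w"
proof
  have fc: "f (x \<odot>\<^bsub>U\<^esub> u) \<in> carrier R" if "x \<in> E" for x
    using V.functionalD[OF f] u that by auto
  show "(\<Oplus>\<^bsub>A\<^esub>x\<in>E. f (x \<odot>\<^bsub>U\<^esub> u) \<odot>\<^bsub>A\<^esub> d x) \<in> carrier A"
    using fc by (intro A.M.finsum_closed) auto
  have "(\<Oplus>\<^bsub>A\<^esub>x\<in>E. f (x \<odot>\<^bsub>U\<^esub> u) \<odot>\<^bsub>A\<^esub> d x) \<odot>\<^bsub>U\<^esub> w = (\<Oplus>\<^bsub>U\<^esub>x\<in>E. (f (x \<odot>\<^bsub>U\<^esub> u) \<odot>\<^bsub>A\<^esub> d x) \<odot>\<^bsub>U\<^esub> w)"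
    using w fc by (intro act_finsum_left) auto
  also have "\<dots> = (\<Oplus>\<^bsub>U\<^esub>x\<in>E. f (x \<odot>\<^bsub>U\<^esub> u) \<odot>\<^bsub>V\<^esub> (d x \<odot>\<^bsub>U\<^esub> w))"
    using w fc V.smult_closed by (intro U.M.finsum_cong') (auto simp: act_smult_left)
  finally show "relative_trace (rank_one f w) u = (\<Oplus>\<^bsub>A\<^esub>x\<in>E. f (x \<odot>\<^bsub>U\<^esub> u) \<odot>\<^bsub>A\<^esub> d x) \<odot>\<^bsub>U\<^esub> w"
    using relative_trace_rank_one[OF f w u] by simp
qed

text \<open>
  The relative trace of \<open>u \<mapsto> f(u) w\<close> is the sum over \<open>x\<close> of the rank one maps \<open>u \<mapsto> f(x u) d(x) w\<close>, with
  traces \<open>f(x d(x) w)\<close>.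
\<close>

lemma trace_relative_trace_rank_one:
  assumes f: "f \<in> functionals R V" and w: "w \<in> carrier U"
    and l: "l \<in> carrier R" and z: "(\<Oplus>\<^bsub>A\<^esub>x\<in>E. x \<otimes>\<^bsub>A\<^esub> d x) = l \<odot>\<^bsub>A\<^esub> \<one>\<^bsub>A\<^esub>"
  shows "linear_trace R V (relative_trace (rank_one f w)) = l \<otimes>\<^bsub>R\<^esub> f w"
proof -
  note fD = V.functionalD[OF f, simplified]
  have Vc: "r \<odot>\<^bsub>V\<^esub> u \<in> carrier U" if "r \<in> carrier R" "u \<in> carrier U" for r u
    using V.smult_closed that by simp
  have "linear_trace R V (relative_trace (rank_one f w)) = 
    linear_trace R V (\<lambda>u. \<Oplus>\<^bsub>V\<^esub>x\<in>E. f (x \<odot>\<^bsub>U\<^esub> u) \<odot>\<^bsub>V\<^esub> (d x \<odot>\<^bsub>U\<^esub> w))"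
    using relative_trace_rank_one[OF f w] V.B_carrier w Vc fD
    by (intro V.linear_trace_cong) (auto intro!: U.M.finsum_closed)
  also have "\<dots> = (\<Oplus>\<^bsub>R\<^esub>x\<in>E. linear_trace R V (\<lambda>u. f (x \<odot>\<^bsub>U\<^esub> u) \<odot>\<^bsub>V\<^esub> (d x \<odot>\<^bsub>U\<^esub> w)))"
    using w Vc fD by (intro V.linear_trace_finsum) auto
  also have "\<dots> = (\<Oplus>\<^bsub>R\<^esub>x\<in>E. f (x \<odot>\<^bsub>U\<^esub> (d x \<odot>\<^bsub>U\<^esub> w)))"
    using w fD by (intro A.R.finsum_cong') (auto simp: V.linear_trace_rank_one functional_act[OF f])
  also have "\<dots> = f (\<Oplus>\<^bsub>V\<^esub>x\<in>E. x \<odot>\<^bsub>U\<^esub> (d x \<odot>\<^bsub>U\<^esub> w))"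
    using w by (intro V.functional_finsum[OF f, symmetric]) auto
  also have "(\<Oplus>\<^bsub>V\<^esub>x\<in>E. x \<odot>\<^bsub>U\<^esub> (d x \<odot>\<^bsub>U\<^esub> w)) = (\<Oplus>\<^bsub>U\<^esub>x\<in>E. (x \<otimes>\<^bsub>A\<^esub> d x) \<odot>\<^bsub>U\<^esub> w)"
    unfolding restrict_scalars_simps using w by (intro U.M.finsum_cong') (auto simp: act_assoc)
  also have "\<dots> = (l \<odot>\<^bsub>A\<^esub> \<one>\<^bsub>A\<^esub>) \<odot>\<^bsub>U\<^esub> w"
    using w by (subst act_finsum_left[symmetric]) (auto simp: z)
  also have "\<dots> = l \<odot>\<^bsub>V\<^esub> w" by (simp add: V_smult)
  finally show ?thesis using fD(4)[OF l w] by simp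
qed

end

section \<open>Dual bases of projective modules\<close>

lemma submodule_finsum_closed:
  assumes "abelian_group M" "submodule P R M" "finite S" "g \<in> S \<rightarrow> P"
  shows "(\<Oplus>\<^bsub>M\<^esub>i\<in>S. g i) \<in> P"
proof -
  interpret M: abelian_group M by fact
  interpret P: submodule P R M by fact
  show ?thesis using assms(3,4)
  proof (induction S rule: finite_induct)
    case empty
    then show ?case using P.one_closed by simp
  next
    case (insert i S)
    then have "g i \<in> P" "finsum M g S \<in> P" "g \<in> S \<rightarrow> carrier M" "g i \<in> carrier M"
      using P.subset by auto
    then show ?case using insert P.m_closed by (simp add: M.finsum_insert)
  qed
qed

lemma free_left_module_simps:
  "ring.zero (free_left_module R I) = (\<lambda>_. \<zero>\<^bsub>R\<^esub>)"
  "add (free_left_module R I) = (\<lambda>f g i. f i \<oplus>\<^bsub>R\<^esub> g i)"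
  "module.smult (free_left_module R I) = (\<lambda>a f i. a \<otimes>\<^bsub>R\<^esub> f i)"
  by (simp_all add: free_left_module_def)

lemma free_left_module_carrier:
  "f \<in> carrier (free_left_module R I) \<longleftrightarrow> (\<forall>i\<in>I. f i \<in> carrier R) \<and> (\<forall>i. i \<notin> I \<longrightarrow> f i = \<zero>\<^bsub>R\<^esub>) \<and>
     finite {i \<in> I. f i \<noteq> \<zero>\<^bsub>R\<^esub>}"
  by (simp add: free_left_module_def)

lemma free_left_module_value:
  assumes "ring R" "f \<in> carrier (free_left_module R I)"
  shows "f i \<in> carrier R"
proof -
  interpret ring R by fact
  show ?thesis using assms(2) by (cases "i \<in> I") (auto simp: free_left_module_carrier)
qed

lemma free_left_module_abelian_group:
  fixes R (structure)
  assumes "ring R"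
  shows "abelian_group (free_left_module R I)"
proof -
  interpret ring R by fact
  let ?F = "free_left_module R I"
  note val = free_left_module_value[OF assms]
  show ?thesis
  proof (rule abelian_groupI)
    fix f g assume fg: "f \<in> carrier ?F" "g \<in> carrier ?F"
    have "{i \<in> I. f i \<oplus> g i \<noteq> \<zero>} \<subseteq> {i \<in> I. f i \<noteq> \<zero>} \<union> {i \<in> I. g i \<noteq> \<zero>}" by auto
    then have "finite {i \<in> I. f i \<oplus> g i \<noteq> \<zero>}"
      using fg by (auto simp: free_left_module_carrier intro: finite_subset)
    then show "f \<oplus>\<^bsub>?F\<^esub> g \<in> carrier ?F"
      using fg by (auto simp: free_left_module_carrier free_left_module_simps)
    show "f \<oplus>\<^bsub>?F\<^esub> g = g \<oplus>\<^bsub>?F\<^esub> f"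
      using val[OF fg(1)] val[OF fg(2)] by (auto simp: free_left_module_simps a_comm)
  next
    show "\<zero>\<^bsub>?F\<^esub> \<in> carrier ?F" by (auto simp: free_left_module_carrier free_left_module_simps)
  next
    fix f g k assume fgk: "f \<in> carrier ?F" "g \<in> carrier ?F" "k \<in> carrier ?F"
    show "f \<oplus>\<^bsub>?F\<^esub> g \<oplus>\<^bsub>?F\<^esub> k = f \<oplus>\<^bsub>?F\<^esub> (g \<oplus>\<^bsub>?F\<^esub> k)"
      using fgk[THEN val] by (auto simp: free_left_module_simps a_assoc)
  next
    fix f assume f: "f \<in> carrier ?F"
    then show "\<zero>\<^bsub>?F\<^esub> \<oplus>\<^bsub>?F\<^esub> f = f" using val[OF f] by (auto simp: free_left_module_simps)
    have "{i \<in> I. \<ominus> f i \<noteq> \<zero>} \<subseteq> {i \<in> I. f i \<noteq> \<zero>}" by auto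
    then have "finite {i \<in> I. \<ominus> f i \<noteq> \<zero>}"
      using f by (auto simp: free_left_module_carrier intro: finite_subset)
    then have "(\<lambda>i. \<ominus> f i) \<in> carrier ?F"
      using f by (auto simp: free_left_module_carrier)
    moreover have "(\<lambda>i. \<ominus> f i) \<oplus>\<^bsub>?F\<^esub> f = \<zero>\<^bsub>?F\<^esub>"
      using val[OF f] by (auto simp: free_left_module_simps l_neg)
    ultimately show "\<exists>g\<in>carrier ?F. g \<oplus>\<^bsub>?F\<^esub> f = \<zero>\<^bsub>?F\<^esub>" by blast
  qed
qed

text \<open>
  Write \<open>h\<close> for the embedding of \<open>M\<close> into a free module \<open>F = P \<oplus> Q\<close> with image \<open>P\<close>. The \<open>\<phi>\<^sub>i\<close> are the coordinates
  of \<open>h\<close>, and \<open>m\<^sub>i\<close> corresponds to the \<open>P\<close>-component of the unit vector \<open>e\<^sub>i\<close>. Restricting the claim to a finite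
  set \<open>S\<close> makes finitely many indices suffice.
\<close>

lemma projective_dual_basis:
  fixes R :: "'a ring" and M :: "('a, 'b) module"
  assumes proj: "projective_module R M" and S: "finite S" "S \<subseteq> carrier M"
  obtains J :: "'b set" and \<phi> m where "finite J" "m \<in> J \<rightarrow> carrier M"
    "\<And>i. i \<in> J \<Longrightarrow> \<phi> i \<in> functionals R M"
    "\<And>x. x \<in> S \<Longrightarrow> x = (\<Oplus>\<^bsub>M\<^esub>i\<in>J. \<phi> i x \<odot>\<^bsub>M\<^esub> m i)"
proof -
  obtain I :: "'b set" and P Q h where M: "left_module R M"
    and PQ: "internal_direct_sum R (free_left_module R I) P Q"
    and h: "h \<in> module_homs R M ((free_left_module R I)\<lparr>carrier := P\<rparr>)"
    and bij: "bij_betw h (carrier M) P"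
    using proj unfolding projective_module_def by blast
  interpret M: left_module R M by (fact M)
  define F where "F = free_left_module R I"
  note PQ = PQ[folded F_def] and h = h[folded F_def]
  interpret F: abelian_group F unfolding F_def by (rule free_left_module_abelian_group[OF M.R.ring_axioms])
  note val = free_left_module_value[OF M.R.ring_axioms, of _ I, folded F_def]
  have P: "submodule P R F" and Q: "submodule Q R F" and int: "P \<inter> Q = {\<zero>\<^bsub>F\<^esub>}" and sum: "P <+>\<^bsub>F\<^esub> Q = carrier F"
    using PQ by (auto simp: internal_direct_sum_def)
  interpret P: submodule P R F by (fact P)
  interpret Q: submodule Q R F by (fact Q)
  have PF: "x \<in> carrier F" if "x \<in> P" for x using P.subset that by auto
  have QF: "x \<in> carrier F" if "x \<in> Q" for x using Q.subset that by auto
  have hP: "h x \<in> P" if "x \<in> carrier M" for x using h that by (auto simp: module_homs_def)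
  have h_add: "h (x \<oplus>\<^bsub>M\<^esub> y) = h x \<oplus>\<^bsub>F\<^esub> h y" if "x \<in> carrier M" "y \<in> carrier M" for x y
    using h that by (auto simp: module_homs_def)
  have h_smult: "h (a \<odot>\<^bsub>M\<^esub> x) = a \<odot>\<^bsub>F\<^esub> h x" if "a \<in> carrier R" "x \<in> carrier M" for a x
    using h that by (auto simp: module_homs_def)
  define e :: "'b \<Rightarrow> 'b \<Rightarrow> 'a" where "e = (\<lambda>i j. if j = i then \<one>\<^bsub>R\<^esub> else \<zero>\<^bsub>R\<^esub>)"
  have eF: "e i \<in> carrier F" if "i \<in> I" for i
  proof -
    have "finite {j \<in> I. e i j \<noteq> \<zero>\<^bsub>R\<^esub>}" by (rule finite_subset[of _ "{i}"]) (auto simp: e_def)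
    then show ?thesis using that by (auto simp: F_def free_left_module_carrier e_def)
  qed
  have "\<exists>p\<in>P. \<exists>q\<in>Q. e i = p \<oplus>\<^bsub>F\<^esub> q" if "i \<in> I" for i
    using eF[OF that] unfolding sum[symmetric] set_add_def' by auto
  then obtain p q where p: "\<And>i. i \<in> I \<Longrightarrow> p i \<in> P" and q: "\<And>i. i \<in> I \<Longrightarrow> q i \<in> Q"
    and e_eq: "\<And>i. i \<in> I \<Longrightarrow> e i = p i \<oplus>\<^bsub>F\<^esub> q i" by metis
  define m where "m = (\<lambda>i. inv_into (carrier M) h (p i))"
  have m: "m i \<in> carrier M" "h (m i) = p i" if "i \<in> I" for i
    using bij p[OF that] unfolding m_def bij_betw_def
    by (auto intro: inv_into_into f_inv_into_f)
  define J where "J = (\<Union>x\<in>S. {i \<in> I. h x i \<noteq> \<zero>\<^bsub>R\<^esub>})"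
  have JI: "J \<subseteq> I" by (auto simp: J_def)
  have hF: "h x \<in> carrier F" if "x \<in> S" for x using S(2) hP PF that by blast
  have finJ: "finite J"
    unfolding J_def using S(1) hF by (auto simp: F_def free_left_module_carrier)
  have hc: "h x i \<in> carrier R" if "x \<in> carrier M" for x i using val PF hP that by blast
  have smF: "a \<odot>\<^bsub>F\<^esub> f \<in> carrier F" if "a \<in> carrier R" "f \<in> carrier F" for a f
  proof -
    have "{i \<in> I. a \<otimes>\<^bsub>R\<^esub> f i \<noteq> \<zero>\<^bsub>R\<^esub>} \<subseteq> {i \<in> I. f i \<noteq> \<zero>\<^bsub>R\<^esub>}" using that(1) by auto
    then have "finite {i \<in> I. a \<otimes>\<^bsub>R\<^esub> f i \<noteq> \<zero>\<^bsub>R\<^esub>}"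
      using that(2) by (auto simp: F_def free_left_module_carrier intro: finite_subset)
    then show ?thesis using that by (auto simp: F_def free_left_module_carrier free_left_module_simps)
  qed
  have "x = (\<Oplus>\<^bsub>M\<^esub>i\<in>J. h x i \<odot>\<^bsub>M\<^esub> m i)" if x: "x \<in> S" for x
  proof -
    have xM: "x \<in> carrier M" using x S by auto
    let ?y = "\<Oplus>\<^bsub>F\<^esub>i\<in>J. h x i \<odot>\<^bsub>F\<^esub> p i" and ?y' = "\<Oplus>\<^bsub>F\<^esub>i\<in>J. h x i \<odot>\<^bsub>F\<^esub> q i"
    have y: "?y \<in> P" using p JI hc[OF xM] finJ
      by (intro submodule_finsum_closed[OF F.abelian_group_axioms P]) auto
    have y': "?y' \<in> Q" using q JI hc[OF xM] finJ
      by (intro submodule_finsum_closed[OF F.abelian_group_axioms Q]) auto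
    \<comment> \<open>Expanding \<open>h x\<close> in unit vectors and splitting each of them, the \<open>Q\<close>-part vanishes as \<open>h x\<close> lies in \<open>P\<close>.\<close>
    have "h x = (\<Oplus>\<^bsub>F\<^esub>i\<in>J. h x i \<odot>\<^bsub>F\<^esub> e i)"
    proof
      fix j
      have "(\<Oplus>\<^bsub>F\<^esub>i\<in>J. h x i \<odot>\<^bsub>F\<^esub> e i) j = (\<Oplus>\<^bsub>R\<^esub>i\<in>J. (h x i \<odot>\<^bsub>F\<^esub> e i) j)"
        by (rule additive_finsum[where f = "\<lambda>g. g j", OF F.abelian_group_axioms M.R.abelian_group_axioms])
          (use finJ JI hc[OF xM] eF smF in \<open>auto simp: val F_def[symmetric], auto simp: F_def free_left_module_simps\<close>)
      also have "\<dots> = (\<Oplus>\<^bsub>R\<^esub>i\<in>J. if j = i then h x i else \<zero>\<^bsub>R\<^esub>)"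
        using hc[OF xM] by (intro M.R.finsum_cong') (auto simp: F_def free_left_module_simps e_def)
      also have "\<dots> = h x j"
      proof (cases "j \<in> J")
        case True
        then show ?thesis using hc[OF xM] finJ by (intro M.R.finsum_singleton) auto
      next
        case False
        then have "h x j = \<zero>\<^bsub>R\<^esub>" using hF[OF x] x by (auto simp: J_def F_def free_left_module_carrier)
        moreover have "(\<Oplus>\<^bsub>R\<^esub>i\<in>J. if j = i then h x i else \<zero>\<^bsub>R\<^esub>) = (\<Oplus>\<^bsub>R\<^esub>i\<in>J. \<zero>\<^bsub>R\<^esub>)"
          using False by (intro M.R.finsum_cong') auto
        ultimately show ?thesis by simp
      qed
      finally show "h x j = (\<Oplus>\<^bsub>F\<^esub>i\<in>J. h x i \<odot>\<^bsub>F\<^esub> e i) j" by simp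
    qed
    also have "\<dots> = (\<Oplus>\<^bsub>F\<^esub>i\<in>J. h x i \<odot>\<^bsub>F\<^esub> p i \<oplus>\<^bsub>F\<^esub> h x i \<odot>\<^bsub>F\<^esub> q i)"
    proof (rule F.finsum_cong'[OF refl])
      fix i assume "i \<in> J"
      then have i: "i \<in> I" using JI by auto
      show "h x i \<odot>\<^bsub>F\<^esub> e i = h x i \<odot>\<^bsub>F\<^esub> p i \<oplus>\<^bsub>F\<^esub> h x i \<odot>\<^bsub>F\<^esub> q i"
        using val[OF PF[OF p[OF i]]] val[OF QF[OF q[OF i]]] hc[OF xM]
        by (auto simp: e_eq[OF i] F_def free_left_module_simps M.R.r_distr)
    qed (use JI p q PF QF hc[OF xM] in auto)
    also have "\<dots> = ?y \<oplus>\<^bsub>F\<^esub> ?y'"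
      using JI p q PF QF hc[OF xM] by (intro F.finsum_addf) auto
    finally have hx: "h x = ?y \<oplus>\<^bsub>F\<^esub> ?y'" .
    have "b = (a \<oplus>\<^bsub>F\<^esub> b) \<ominus>\<^bsub>F\<^esub> a" if "a \<in> carrier F" "b \<in> carrier F" for a b
      using that by (simp add: a_minus_def F.a_comm[of a b] F.a_assoc F.r_neg)
    from this[OF PF[OF y] QF[OF y']] have "?y' = (?y \<oplus>\<^bsub>F\<^esub> ?y') \<ominus>\<^bsub>F\<^esub> ?y" .
    also have "?y \<oplus>\<^bsub>F\<^esub> ?y' = h x" by (rule hx[symmetric])
    also have "h x \<ominus>\<^bsub>F\<^esub> ?y \<in> P"
      using P.m_closed[OF hP[OF xM] P.m_inv_closed[OF y]] by (simp only: a_minus_def a_inv_def monoid.simps)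
    finally have "?y' = \<zero>\<^bsub>F\<^esub>" using y' int by auto
    with hx have "h x = ?y \<oplus>\<^bsub>F\<^esub> \<zero>\<^bsub>F\<^esub>" by (rule subst[of _ _ "\<lambda>q. h x = ?y \<oplus>\<^bsub>F\<^esub> q", rotated])
    also have "\<dots> = ?y" by (rule F.r_zero[OF PF[OF y]])
    also have "\<dots> = (\<Oplus>\<^bsub>F\<^esub>i\<in>J. h (h x i \<odot>\<^bsub>M\<^esub> m i))"
      using JI hc[OF xM] m p PF by (intro F.finsum_cong') (auto simp: h_smult subset_iff)
    also have "\<dots> = h (\<Oplus>\<^bsub>M\<^esub>i\<in>J. h x i \<odot>\<^bsub>M\<^esub> m i)"
      by (rule additive_finsum[symmetric, OF M.M.abelian_group_axioms F.abelian_group_axioms])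
        (use JI hc[OF xM] m hP PF h_add finJ M.smult_closed in \<open>auto simp: subset_iff\<close>)
    finally show ?thesis
      using bij xM JI hc[OF xM] m M.smult_closed unfolding bij_betw_def
      by (auto dest!: inj_onD intro!: M.M.finsum_closed simp: subset_iff)
  qed
  moreover have "(\<lambda>x. h x i) \<in> functionals R M" if "i \<in> J" for i
    using hc h_add h_smult by (auto simp: module_homs_def F_def free_left_module_simps)
  ultimately show ?thesis
    using that[of J m "\<lambda>i x. h x i"] finJ m JI by blast
qed

section \<open>Unimodular vectors of a projective Knoerr lattice\<close>

text \<open>
  The property of \<open>U\<close> from which both simplicity statements follow.
\<close>

locale unimodular_generation = algebra_lattice +
  assumes pid: "principal_domain R"
    and nonzero: "carrier U \<noteq> {\<zero>\<^bsub>U\<^esub>}"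
    and generates: "\<lbrakk>f \<in> functionals R V; w \<in> carrier U; f w = \<one>\<^bsub>R\<^esub>; u \<in> carrier U\<rbrakk> \<Longrightarrow>
           \<exists>a\<in>carrier A. u = a \<odot>\<^bsub>U\<^esub> w"

context dual_bases
begin

text \<open>
  With a projective dual basis \<open>\<phi>\<^sub>i\<close>, \<open>m\<^sub>i\<close>, the identity is a sum of relative traces of the rank one maps
  \<open>u \<mapsto> s(\<phi>\<^sub>i(u)) m\<^sub>i\<close>. Its linear trace, the rank, is therefore \<open>l \<Sum> s(\<phi>\<^sub>i(m\<^sub>i))\<close>. Checking the identity on a
  basis of the lattice is enough.
\<close>

lemma rank_multiple:
  assumes proj: "projective_module (underlying_ring A) U"
    and l: "l \<in> carrier R" and z: "(\<Oplus>\<^bsub>A\<^esub>x\<in>E. x \<otimes>\<^bsub>A\<^esub> d x) = l \<odot>\<^bsub>A\<^esub> \<one>\<^bsub>A\<^esub>"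
  obtains t where "t \<in> carrier R" "[free_rank R V] \<cdot>\<^bsub>R\<^esub> \<one>\<^bsub>R\<^esub> = l \<otimes>\<^bsub>R\<^esub> t"
proof -
  obtain J :: "'c set" and \<phi> m where J: "finite J" and mJ: "m \<in> J \<rightarrow> carrier U"
    and \<phi>: "\<And>i. i \<in> J \<Longrightarrow> \<phi> i \<in> functionals (underlying_ring A) U"
    and exp: "\<And>b. b \<in> V.B \<Longrightarrow> b = (\<Oplus>\<^bsub>U\<^esub>i\<in>J. \<phi> i b \<odot>\<^bsub>U\<^esub> m i)"
    by (rule projective_dual_basis[OF proj V.finite_B]) (use V.B_carrier in auto)
  have m: "m i \<in> carrier U" if "i \<in> J" for i using mJ that by auto
  have \<phi>c: "\<phi> i u \<in> carrier A" if "i \<in> J" "u \<in> carrier U" for i u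
    using \<phi>[OF that(1)] that(2) by (auto simp: module_homs_def)
  have \<phi>_add: "\<phi> i (u \<oplus>\<^bsub>U\<^esub> v) = \<phi> i u \<oplus>\<^bsub>A\<^esub> \<phi> i v" if "i \<in> J" "u \<in> carrier U" "v \<in> carrier U" for i u v
    using \<phi>[OF that(1)] that(2,3) by (auto simp: module_homs_def)
  have \<phi>_act: "\<phi> i (a \<odot>\<^bsub>U\<^esub> u) = a \<otimes>\<^bsub>A\<^esub> \<phi> i u" if "i \<in> J" "u \<in> carrier U" "a \<in> carrier A" for i u a
    using \<phi>[OF that(1)] that(2,3) by (auto simp: module_homs_def)
  define f where "f = (\<lambda>i u. s (\<phi> i u))"
  have f: "f i \<in> functionals R V" if i: "i \<in> J" for i
    using \<phi>c[OF i] \<phi>_add[OF i] \<phi>_act[OF i] sD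
    by (auto simp: module_homs_def f_def V_smult A.smult_mult_left)
  have id: "b = (\<Oplus>\<^bsub>V\<^esub>i\<in>J. relative_trace (rank_one (f i) (m i)) b)" if b: "b \<in> V.B" for b
  proof -
    have bU: "b \<in> carrier U" using V.B_carrier[OF b] by simp
    have eq: "\<phi> i b \<odot>\<^bsub>U\<^esub> m i = relative_trace (rank_one (f i) (m i)) b" if i: "i \<in> J" for i
    proof -
      have sc: "s (x \<otimes>\<^bsub>A\<^esub> \<phi> i b) \<in> carrier R" if "x \<in> E" for x
        using sD(2) \<phi>c[OF i bU] that by simp
      have "\<phi> i b \<odot>\<^bsub>U\<^esub> m i = (\<Oplus>\<^bsub>A\<^esub>x\<in>E. s (x \<otimes>\<^bsub>A\<^esub> \<phi> i b) \<odot>\<^bsub>A\<^esub> d x) \<odot>\<^bsub>U\<^esub> m i"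
        using dual_expansion[OF \<phi>c[OF i bU]] by simp
      also have "\<dots> = (\<Oplus>\<^bsub>U\<^esub>x\<in>E. (s (x \<otimes>\<^bsub>A\<^esub> \<phi> i b) \<odot>\<^bsub>A\<^esub> d x) \<odot>\<^bsub>U\<^esub> m i)"
        using m[OF i] sc by (intro act_finsum_left) auto
      also have "\<dots> = (\<Oplus>\<^bsub>U\<^esub>x\<in>E. f i (x \<odot>\<^bsub>U\<^esub> b) \<odot>\<^bsub>V\<^esub> (d x \<odot>\<^bsub>U\<^esub> m i))"
        using m[OF i] sc V.smult_closed \<phi>_act[OF i bU]
        by (intro U.M.finsum_cong') (auto simp: act_smult_left f_def)
      finally show ?thesis using relative_trace_rank_one[OF f[OF i] m[OF i] bU] by simp
    qed
    then have "(\<Oplus>\<^bsub>U\<^esub>i\<in>J. \<phi> i b \<odot>\<^bsub>U\<^esub> m i) = (\<Oplus>\<^bsub>U\<^esub>i\<in>J. relative_trace (rank_one (f i) (m i)) b)"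
      using m \<phi>c bU by (intro U.M.finsum_cong') (auto simp: eq[symmetric])
    then show ?thesis using exp[OF b] by simp
  qed
  have relative_trace_closed: "relative_trace (rank_one (f i) (m i)) \<in> carrier U \<rightarrow> carrier U" if "i \<in> J" for i
    using relative_trace_hom[OF rank_one_hom[OF f[OF that] m[OF that]]] by (auto simp: module_homs_def)
  have fm: "f i (m i) \<in> carrier R" if "i \<in> J" for i
    using V.functionalD(2)[OF f[OF that]] m[OF that] by simp
  have "[free_rank R V] \<cdot>\<^bsub>R\<^esub> \<one>\<^bsub>R\<^esub> = linear_trace R V (\<lambda>u. u)" by (simp add: V.linear_trace_id)
  also have "\<dots> = linear_trace R V (\<lambda>u. \<Oplus>\<^bsub>V\<^esub>i\<in>J. relative_trace (rank_one (f i) (m i)) u)"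
    using id relative_trace_closed by (intro V.linear_trace_cong) (auto intro!: U.M.finsum_closed)
  also have "\<dots> = (\<Oplus>\<^bsub>R\<^esub>i\<in>J. linear_trace R V (relative_trace (rank_one (f i) (m i))))"
    using J relative_trace_closed by (intro V.linear_trace_finsum) auto
  also have "\<dots> = (\<Oplus>\<^bsub>R\<^esub>i\<in>J. l \<otimes>\<^bsub>R\<^esub> f i (m i))"
    using l fm m f by (intro A.R.finsum_cong') (auto simp: trace_relative_trace_rank_one[OF _ _ l z])
  also have "\<dots> = l \<otimes>\<^bsub>R\<^esub> (\<Oplus>\<^bsub>R\<^esub>i\<in>J. f i (m i))"
    using J l fm by (intro A.R.finsum_rdistr[symmetric]) auto
  finally show ?thesis using that[of "\<Oplus>\<^bsub>R\<^esub>i\<in>J. f i (m i)"] fm A.R.finsum_closed by auto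
qed

text \<open>
  The relative trace of \<open>u \<mapsto> f(u) w\<close> has linear trace \<open>l f(w) = l\<close>. Since \<open>l\<close> and the rank generate the same ideal,
  the Knoerr condition makes it bijective, while all its values are multiples of \<open>w\<close>.
\<close>

lemma unimodular_generates:
  assumes proj: "projective_module (underlying_ring A) U" and knorr: "knorr_lattice R A U"
    and l: "l \<in> carrier R" and z: "(\<Oplus>\<^bsub>A\<^esub>x\<in>E. x \<otimes>\<^bsub>A\<^esub> d x) = l \<odot>\<^bsub>A\<^esub> \<one>\<^bsub>A\<^esub>"
    and f: "f \<in> functionals R V" and w: "w \<in> carrier U" and fw: "f w = \<one>\<^bsub>R\<^esub>"
    and u: "u \<in> carrier U"
  shows "\<exists>a\<in>carrier A. u = a \<odot>\<^bsub>U\<^esub> w"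
proof -
  let ?\<alpha> = "relative_trace (rank_one f w)" and ?n = "[free_rank R V] \<cdot>\<^bsub>R\<^esub> \<one>\<^bsub>R\<^esub>"
  have tr: "linear_trace R V ?\<alpha> = l"
    using trace_relative_trace_rank_one[OF f w l z] fw l by simp
  have "?\<alpha> \<in> module_homs (underlying_ring A) U U"
    using relative_trace_hom[OF rank_one_hom[OF f w]] .
  then have sub: "PIdl\<^bsub>R\<^esub> l \<subseteq> PIdl\<^bsub>R\<^esub> ?n"
    and iff: "PIdl\<^bsub>R\<^esub> l = PIdl\<^bsub>R\<^esub> ?n \<longleftrightarrow> bij_betw ?\<alpha> (carrier U) (carrier U)"
    using knorr tr unfolding knorr_lattice_def Let_def by auto
  obtain t where t: "t \<in> carrier R" "?n = l \<otimes>\<^bsub>R\<^esub> t" using rank_multiple[OF proj l z] .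
  have "?n \<in> PIdl\<^bsub>R\<^esub> l" using t l A.R.m_comm by (auto simp: cgenideal_def)
  then have "PIdl\<^bsub>R\<^esub> ?n \<subseteq> PIdl\<^bsub>R\<^esub> l"
    using A.R.cgenideal_minimal[OF A.R.cgenideal_ideal[OF l]] by simp
  with sub iff have "bij_betw ?\<alpha> (carrier U) (carrier U)" by blast
  then obtain u' where "u' \<in> carrier U" "?\<alpha> u' = u"
    using u unfolding bij_betw_def by (metis imageE)
  then show ?thesis using relative_trace_rank_one_cyclic[OF f w] by metis
qed

end

section \<open>Reduction modulo a maximal ideal\<close>

lemma (in cring) maximal_principal_ideal_comaximal:
  assumes max: "maximalideal (PIdl \<pi>) R" and \<pi>: "\<pi> \<in> carrier R"
    and g: "g \<in> carrier R" "g \<notin> PIdl \<pi>"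
  obtains c r where "c \<in> carrier R" "r \<in> carrier R" "\<one> = c \<otimes> \<pi> \<oplus> r \<otimes> g"
proof -
  interpret max: maximalideal "PIdl \<pi>" R by (fact max)
  let ?J = "PIdl \<pi> <+>\<^bsub>R\<^esub> PIdl g"
  have J: "c \<otimes> \<pi> \<oplus> r \<otimes> g \<in> ?J" if "c \<in> carrier R" "r \<in> carrier R" for c r
    using that unfolding set_add_def' cgenideal_def by blast
  have J_ideal: "ideal ?J R"
    using add_ideals[OF cgenideal_ideal[OF \<pi>] cgenideal_ideal[OF g(1)]] .
  have "PIdl \<pi> \<subseteq> ?J"
  proof
    fix x assume "x \<in> PIdl \<pi>"
    then obtain c where c: "c \<in> carrier R" "x = c \<otimes> \<pi>" unfolding cgenideal_def by blast
    then show "x \<in> ?J" using J[of c \<zero>] \<pi> g(1) by simp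
  qed
  moreover have "?J \<subseteq> carrier R" using additive_subgroup.a_subset[OF ideal.axioms(1)[OF J_ideal]] .
  ultimately have "?J = PIdl \<pi> \<or> ?J = carrier R" using max.I_maximal[OF J_ideal] by blast
  moreover have "g \<in> ?J" using J[of \<zero> \<one>] \<pi> g(1) by simp
  ultimately have "\<one> \<in> ?J" using g(2) by auto
  then show ?thesis using that unfolding set_add_def' cgenideal_def by blast
qed

text \<open>
  The action of cosets is well defined because \<open>(i + a)(n + x) = (i (n + x) + a n) + a x\<close> differs from \<open>a x\<close> by an
  element of \<open>N\<close> whenever \<open>i\<close> is in \<open>I\<close> and \<open>n\<close> in \<open>N\<close>.
\<close>

lemma coset_action_module:
  fixes S :: "'a ring" and M :: "('a, 'b) module"
  assumes M: "left_module S M" and I: "ideal I S" and N: "submodule N S M"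
    and IN: "\<And>a x. a \<in> I \<Longrightarrow> x \<in> carrier M \<Longrightarrow> a \<odot>\<^bsub>M\<^esub> x \<in> N"
  shows quotient_smult: "\<And>a x. a \<in> carrier S \<Longrightarrow> x \<in> carrier M \<Longrightarrow>
      (I +>\<^bsub>S\<^esub> a) \<odot>\<^bsub>quotient_module M N\<^esub> (N +>\<^bsub>M\<^esub> x) = N +>\<^bsub>M\<^esub> (a \<odot>\<^bsub>M\<^esub> x)"
    and quotient_left_module: "left_module (S Quot I) (quotient_module M N)"
proof -
  interpret M: left_module S M by (fact M)
  interpret I: ideal I S by (fact I)
  interpret N: submodule N S M by (fact N)
  interpret N: abelian_subgroup N M
    by (intro abelian_subgroupI3 additive_subgroup.intro N.subgroup_axioms M.M.abelian_group_axioms)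
  let ?Q = "quotient_module M N"
  have NM: "n \<in> carrier M" if "n \<in> N" for n using N.a_subset that by auto
  show sm: "(I +>\<^bsub>S\<^esub> a) \<odot>\<^bsub>?Q\<^esub> (N +>\<^bsub>M\<^esub> x) = N +>\<^bsub>M\<^esub> (a \<odot>\<^bsub>M\<^esub> x)"
    if a: "a \<in> carrier S" and x: "x \<in> carrier M" for a x
  proof -
    have eq: "N +>\<^bsub>M\<^esub> (a' \<odot>\<^bsub>M\<^esub> x') = N +>\<^bsub>M\<^esub> (a \<odot>\<^bsub>M\<^esub> x)"
      if a': "a' \<in> I +>\<^bsub>S\<^esub> a" and x': "x' \<in> N +>\<^bsub>M\<^esub> x" for a' x'
    proof -
      obtain i where i: "i \<in> I" "a' = i \<oplus>\<^bsub>S\<^esub> a" using a' by (auto simp: a_r_coset_def')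
      obtain n where n: "n \<in> N" "x' = n \<oplus>\<^bsub>M\<^esub> x" using x' by (auto simp: a_r_coset_def')
      have iS: "i \<in> carrier S" using i I.a_subset by auto
      have x'M: "x' \<in> carrier M" using n NM x by auto
      have "a' \<odot>\<^bsub>M\<^esub> x' = i \<odot>\<^bsub>M\<^esub> x' \<oplus>\<^bsub>M\<^esub> (a \<odot>\<^bsub>M\<^esub> n \<oplus>\<^bsub>M\<^esub> a \<odot>\<^bsub>M\<^esub> x)"
        using M.smult_l_distr[OF iS a x'M] M.smult_r_distr[OF a NM[OF n(1)] x]
        by (simp only: i(2) n(2)[symmetric])
      also have "\<dots> = (i \<odot>\<^bsub>M\<^esub> x' \<oplus>\<^bsub>M\<^esub> a \<odot>\<^bsub>M\<^esub> n) \<oplus>\<^bsub>M\<^esub> a \<odot>\<^bsub>M\<^esub> x"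
        using iS a x NM[OF n(1)] x'M by (simp add: M.smult_closed M.M.a_assoc)
      also have "\<dots> \<in> N +>\<^bsub>M\<^esub> (a \<odot>\<^bsub>M\<^esub> x)"
        using IN[OF i(1) x'M] N.smult_closed[OF a n(1)] by (auto simp: a_r_coset_def')
      finally show ?thesis
        using N.a_repr_independence'[OF _ M.smult_closed[OF a x]] by simp
    qed
    have "(I +>\<^bsub>S\<^esub> a) \<odot>\<^bsub>?Q\<^esub> (N +>\<^bsub>M\<^esub> x) = (\<Union>a'\<in>I +>\<^bsub>S\<^esub> a. \<Union>x'\<in>N +>\<^bsub>M\<^esub> x. N +>\<^bsub>M\<^esub> (a' \<odot>\<^bsub>M\<^esub> x'))"
      by (simp add: quotient_module_def)
    also have "\<dots> = (\<Union>a'\<in>I +>\<^bsub>S\<^esub> a. \<Union>x'\<in>N +>\<^bsub>M\<^esub> x. N +>\<^bsub>M\<^esub> (a \<odot>\<^bsub>M\<^esub> x))"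
      by (intro SUP_cong refl eq)
    also have "\<dots> = N +>\<^bsub>M\<^esub> (a \<odot>\<^bsub>M\<^esub> x)"
    proof -
      have "I +>\<^bsub>S\<^esub> a \<noteq> {}" "N +>\<^bsub>M\<^esub> x \<noteq> {}"
        using I.a_rcos_self[OF a] N.a_rcos_self[OF x] by blast+
      then show ?thesis by (simp only: UN_constant if_False)
    qed
    finally show ?thesis .
  qed
  have carr: "C \<in> carrier ?Q \<longleftrightarrow> (\<exists>x\<in>carrier M. C = N +>\<^bsub>M\<^esub> x)" for C
    by (auto simp: quotient_module_def A_RCOSETS_def')
  have add: "(N +>\<^bsub>M\<^esub> x) \<oplus>\<^bsub>?Q\<^esub> (N +>\<^bsub>M\<^esub> y) = N +>\<^bsub>M\<^esub> (x \<oplus>\<^bsub>M\<^esub> y)" if "x \<in> carrier M" "y \<in> carrier M" for x y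
    using that by (simp add: quotient_module_def N.a_rcos_sum)
  have carr': "C \<in> carrier (S Quot I) \<longleftrightarrow> (\<exists>a\<in>carrier S. C = I +>\<^bsub>S\<^esub> a)" for C
    by (auto simp: FactRing_def A_RCOSETS_def')
  have ops: "(I +>\<^bsub>S\<^esub> a) \<oplus>\<^bsub>S Quot I\<^esub> (I +>\<^bsub>S\<^esub> b) = I +>\<^bsub>S\<^esub> (a \<oplus>\<^bsub>S\<^esub> b)"
      "(I +>\<^bsub>S\<^esub> a) \<otimes>\<^bsub>S Quot I\<^esub> (I +>\<^bsub>S\<^esub> b) = I +>\<^bsub>S\<^esub> (a \<otimes>\<^bsub>S\<^esub> b)"
      if "a \<in> carrier S" "b \<in> carrier S" for a b
    using that by (simp_all add: FactRing_def I.a_rcos_sum I.rcoset_mult_add)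
  have one: "\<one>\<^bsub>S Quot I\<^esub> = I +>\<^bsub>S\<^esub> \<one>\<^bsub>S\<^esub>" by (simp add: FactRing_def)
  show "left_module (S Quot I) ?Q"
  proof (intro left_module.intro left_module_axioms.intro)
    show "ring (S Quot I)" by (rule I.quotient_is_ring)
    have zero: "\<zero>\<^bsub>?Q\<^esub> = N +>\<^bsub>M\<^esub> \<zero>\<^bsub>M\<^esub>"
      using M.M.a_coset_add_zero[OF N.a_subset] by (simp add: quotient_module_def)
    show "abelian_group ?Q"
    proof (rule abelian_groupI)
      show "\<zero>\<^bsub>?Q\<^esub> \<in> carrier ?Q" unfolding carr zero by blast
    next
      fix C D assume "C \<in> carrier ?Q" "D \<in> carrier ?Q"
      then obtain x y where "x \<in> carrier M" "C = N +>\<^bsub>M\<^esub> x" "y \<in> carrier M" "D = N +>\<^bsub>M\<^esub> y"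
        unfolding carr by blast
      then show "C \<oplus>\<^bsub>?Q\<^esub> D \<in> carrier ?Q" "C \<oplus>\<^bsub>?Q\<^esub> D = D \<oplus>\<^bsub>?Q\<^esub> C"
        unfolding carr by (auto simp: add M.M.a_comm)
    next
      fix C D D' assume "C \<in> carrier ?Q" "D \<in> carrier ?Q" "D' \<in> carrier ?Q"
      then obtain x y z where "x \<in> carrier M" "C = N +>\<^bsub>M\<^esub> x" "y \<in> carrier M" "D = N +>\<^bsub>M\<^esub> y"
          "z \<in> carrier M" "D' = N +>\<^bsub>M\<^esub> z"
        unfolding carr by blast
      then show "C \<oplus>\<^bsub>?Q\<^esub> D \<oplus>\<^bsub>?Q\<^esub> D' = C \<oplus>\<^bsub>?Q\<^esub> (D \<oplus>\<^bsub>?Q\<^esub> D')"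
        by (simp add: add M.M.a_assoc)
    next
      fix C assume "C \<in> carrier ?Q"
      then obtain x where x: "x \<in> carrier M" "C = N +>\<^bsub>M\<^esub> x" unfolding carr by blast
      then show "\<zero>\<^bsub>?Q\<^esub> \<oplus>\<^bsub>?Q\<^esub> C = C" by (simp add: zero add)
      have "(N +>\<^bsub>M\<^esub> (\<ominus>\<^bsub>M\<^esub> x)) \<oplus>\<^bsub>?Q\<^esub> C = \<zero>\<^bsub>?Q\<^esub>"
        using x by (simp add: zero add M.M.l_neg)
      moreover have "N +>\<^bsub>M\<^esub> (\<ominus>\<^bsub>M\<^esub> x) \<in> carrier ?Q" unfolding carr using x(1) by blast
      ultimately show "\<exists>D\<in>carrier ?Q. D \<oplus>\<^bsub>?Q\<^esub> C = \<zero>\<^bsub>?Q\<^esub>" by blast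
    qed
  next
    fix C D assume "C \<in> carrier (S Quot I)" "D \<in> carrier ?Q"
    then show "C \<odot>\<^bsub>?Q\<^esub> D \<in> carrier ?Q"
      unfolding carr carr' using sm M.smult_closed by fastforce
  next
    fix C C' D assume "C \<in> carrier (S Quot I)" "C' \<in> carrier (S Quot I)" "D \<in> carrier ?Q"
    then obtain a b x where "a \<in> carrier S" "b \<in> carrier S" "x \<in> carrier M"
      "C = I +>\<^bsub>S\<^esub> a" "C' = I +>\<^bsub>S\<^esub> b" "D = N +>\<^bsub>M\<^esub> x"
      unfolding carr carr' by blast
    then show "(C \<oplus>\<^bsub>S Quot I\<^esub> C') \<odot>\<^bsub>?Q\<^esub> D = C \<odot>\<^bsub>?Q\<^esub> D \<oplus>\<^bsub>?Q\<^esub> C' \<odot>\<^bsub>?Q\<^esub> D"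
      and "(C \<otimes>\<^bsub>S Quot I\<^esub> C') \<odot>\<^bsub>?Q\<^esub> D = C \<odot>\<^bsub>?Q\<^esub> (C' \<odot>\<^bsub>?Q\<^esub> D)"
      using M.smult_closed by (simp_all add: ops add sm M.smult_l_distr M.smult_assoc)
  next
    fix C D D' assume "C \<in> carrier (S Quot I)" "D \<in> carrier ?Q" "D' \<in> carrier ?Q"
    then obtain a x y where "a \<in> carrier S" "x \<in> carrier M" "y \<in> carrier M"
      "C = I +>\<^bsub>S\<^esub> a" "D = N +>\<^bsub>M\<^esub> x" "D' = N +>\<^bsub>M\<^esub> y"
      unfolding carr carr' by blast
    then show "C \<odot>\<^bsub>?Q\<^esub> (D \<oplus>\<^bsub>?Q\<^esub> D') = C \<odot>\<^bsub>?Q\<^esub> D \<oplus>\<^bsub>?Q\<^esub> C \<odot>\<^bsub>?Q\<^esub> D'"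
      using M.smult_closed by (simp add: add sm M.smult_r_distr)
  next
    fix D assume "D \<in> carrier ?Q"
    then obtain x where "x \<in> carrier M" "D = N +>\<^bsub>M\<^esub> x" unfolding carr by blast
    then show "\<one>\<^bsub>S Quot I\<^esub> \<odot>\<^bsub>?Q\<^esub> D = D" by (simp add: one sm M.smult_unital)
  qed
qed

lemma a_inv_transfer [simp]:
  "a_inv (underlying_ring A) = a_inv A" "a_inv (restrict_scalars A U) = a_inv U"
  by (simp_all add: a_inv_def m_inv_def fun_eq_iff)

context algebra_lattice
begin

lemma smult_image_ideal:
  assumes r: "r \<in> carrier R"
  shows "ideal ((\<lambda>a. r \<odot>\<^bsub>A\<^esub> a) ` carrier A) (underlying_ring A)"
proof (rule idealI[OF U.R.ring_axioms])
  show "subgroup ((\<lambda>a. r \<odot>\<^bsub>A\<^esub> a) ` carrier A) (add_monoid (underlying_ring A))"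
  proof (rule U.R.add.subgroupI)
    fix x y assume "x \<in> (\<lambda>a. r \<odot>\<^bsub>A\<^esub> a) ` carrier A" "y \<in> (\<lambda>a. r \<odot>\<^bsub>A\<^esub> a) ` carrier A"
    then obtain a b where ab: "a \<in> carrier A" "b \<in> carrier A" "x = r \<odot>\<^bsub>A\<^esub> a" "y = r \<odot>\<^bsub>A\<^esub> b" by auto
    then have "x \<oplus>\<^bsub>A\<^esub> y = r \<odot>\<^bsub>A\<^esub> (a \<oplus>\<^bsub>A\<^esub> b)" using r by (simp add: A.smult_r_distr)
    then show "x \<oplus>\<^bsub>underlying_ring A\<^esub> y \<in> (\<lambda>a. r \<odot>\<^bsub>A\<^esub> a) ` carrier A" using ab by auto
  next
    fix x assume "x \<in> (\<lambda>a. r \<odot>\<^bsub>A\<^esub> a) ` carrier A"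
    then obtain a where a: "a \<in> carrier A" "x = r \<odot>\<^bsub>A\<^esub> a" by auto
    then have "\<ominus>\<^bsub>A\<^esub> x = r \<odot>\<^bsub>A\<^esub> (\<ominus>\<^bsub>A\<^esub> a)" using r by (simp add: A.smult_r_minus)
    then show "\<ominus>\<^bsub>underlying_ring A\<^esub> x \<in> (\<lambda>a. r \<odot>\<^bsub>A\<^esub> a) ` carrier A" using a by auto
  qed (use r in auto)
next
  fix x b assume "x \<in> (\<lambda>a. r \<odot>\<^bsub>A\<^esub> a) ` carrier A" and b: "b \<in> carrier (underlying_ring A)"
  then obtain a where a: "a \<in> carrier A" "x = r \<odot>\<^bsub>A\<^esub> a" by auto
  show "b \<otimes>\<^bsub>underlying_ring A\<^esub> x \<in> (\<lambda>a. r \<odot>\<^bsub>A\<^esub> a) ` carrier A"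
    using a b r by (auto simp: A.smult_mult_right)
  show "x \<otimes>\<^bsub>underlying_ring A\<^esub> b \<in> (\<lambda>a. r \<odot>\<^bsub>A\<^esub> a) ` carrier A"
    using a b r by (auto simp: A.smult_mult_left)
qed

lemma V_smult_closed [simp, intro]: "r \<in> carrier R \<Longrightarrow> u \<in> carrier U \<Longrightarrow> r \<odot>\<^bsub>V\<^esub> u \<in> carrier U"
  using V.smult_closed by simp

lemma smult_image_submodule:
  assumes r: "r \<in> carrier R"
  shows "submodule ((\<lambda>u. r \<odot>\<^bsub>V\<^esub> u) ` carrier U) (underlying_ring A) U"
proof (intro submodule.intro submodule_axioms.intro)
  show "subgroup ((\<lambda>u. r \<odot>\<^bsub>V\<^esub> u) ` carrier U) (add_monoid U)"
  proof (rule U.M.add.subgroupI)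
    fix x y assume "x \<in> (\<lambda>u. r \<odot>\<^bsub>V\<^esub> u) ` carrier U" "y \<in> (\<lambda>u. r \<odot>\<^bsub>V\<^esub> u) ` carrier U"
    then obtain a b where ab: "a \<in> carrier U" "b \<in> carrier U" "x = r \<odot>\<^bsub>V\<^esub> a" "y = r \<odot>\<^bsub>V\<^esub> b" by auto
    then have "x \<oplus>\<^bsub>U\<^esub> y = r \<odot>\<^bsub>V\<^esub> (a \<oplus>\<^bsub>U\<^esub> b)" using r V.smult_r_distr by simp
    then show "x \<oplus>\<^bsub>U\<^esub> y \<in> (\<lambda>u. r \<odot>\<^bsub>V\<^esub> u) ` carrier U" using ab by auto
  next
    fix x assume "x \<in> (\<lambda>u. r \<odot>\<^bsub>V\<^esub> u) ` carrier U"
    then obtain a where a: "a \<in> carrier U" "x = r \<odot>\<^bsub>V\<^esub> a" by auto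
    then have "\<ominus>\<^bsub>U\<^esub> x = r \<odot>\<^bsub>V\<^esub> (\<ominus>\<^bsub>U\<^esub> a)" using r V.smult_r_minus by simp
    then show "\<ominus>\<^bsub>U\<^esub> x \<in> (\<lambda>u. r \<odot>\<^bsub>V\<^esub> u) ` carrier U" using a by auto
  qed (use r in auto)
next
  fix b x assume b: "b \<in> carrier (underlying_ring A)" and "x \<in> (\<lambda>u. r \<odot>\<^bsub>V\<^esub> u) ` carrier U"
  then obtain u where "u \<in> carrier U" "x = r \<odot>\<^bsub>V\<^esub> u" by auto
  then show "b \<odot>\<^bsub>U\<^esub> x \<in> (\<lambda>u. r \<odot>\<^bsub>V\<^esub> u) ` carrier U"
    using b r by (auto simp: act_smult_right)
qed

end

context unimodular_generation
begin

text \<open>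
  A coset of \<open>u = g w\<close> outside \<open>\<pi> U\<close> has \<open>g\<close> coprime to \<open>\<pi>\<close>, say \<open>1 = c \<pi> + r g\<close>. Then
  \<open>v = a w\<close> is congruent to \<open>r g a w = (r a) u\<close> modulo \<open>\<pi> U\<close>.
\<close>

lemma reduction_simple:
  assumes \<pi>: "\<pi> \<in> carrier R" and max: "maximalideal (PIdl\<^bsub>R\<^esub> \<pi>) R"
  shows "simple_module (underlying_ring A Quot ((\<lambda>a. \<pi> \<odot>\<^bsub>A\<^esub> a) ` carrier A))
           (quotient_module U ((\<lambda>u. \<pi> \<odot>\<^bsub>V\<^esub> u) ` carrier U))"
proof -
  let ?I = "(\<lambda>a. \<pi> \<odot>\<^bsub>A\<^esub> a) ` carrier A" and ?N = "(\<lambda>u. \<pi> \<odot>\<^bsub>V\<^esub> u) ` carrier U"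
  let ?Q = "quotient_module U ?N" and ?S = "underlying_ring A"
  interpret max: maximalideal "PIdl\<^bsub>R\<^esub> \<pi>" R by (fact max)
  have I: "ideal ?I ?S" and N: "submodule ?N ?S U"
    using smult_image_ideal[OF \<pi>] smult_image_submodule[OF \<pi>] .
  interpret N: submodule ?N ?S U by (fact N)
  interpret N: abelian_subgroup ?N U
    by (intro abelian_subgroupI3 additive_subgroup.intro N.subgroup_axioms U.M.abelian_group_axioms)
  have IN: "a \<odot>\<^bsub>U\<^esub> u \<in> ?N" if "a \<in> ?I" "u \<in> carrier U" for a u
    using that \<pi> by (auto simp: act_smult_left)
  note sm = quotient_smult[OF U.left_module_axioms I N IN, simplified]
  have Q: "left_module (?S Quot ?I) ?Q"
    by (rule quotient_left_module[OF U.left_module_axioms I N IN])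
  have carr: "C \<in> carrier ?Q \<longleftrightarrow> (\<exists>x\<in>carrier U. C = ?N +>\<^bsub>U\<^esub> x)" for C
    by (auto simp: quotient_module_def A_RCOSETS_def')
  have zero: "\<zero>\<^bsub>?Q\<^esub> = ?N" by (simp add: quotient_module_def)
  have coset_zero: "?N +>\<^bsub>U\<^esub> x = ?N \<longleftrightarrow> x \<in> ?N" if "x \<in> carrier U" for x
    using N.a_rcos_self[OF that] N.a_rcos_const by auto
  have factor: "\<exists>g\<in>carrier R. \<exists>w\<in>carrier U. \<exists>f\<in>functionals R V. f w = \<one>\<^bsub>R\<^esub> \<and> u = g \<odot>\<^bsub>V\<^esub> w"
    if "u \<in> carrier U" "u \<noteq> \<zero>\<^bsub>U\<^esub>" for u
    by (rule V.unimodular_factor[OF pid, of u]) (use that in \<open>simp_all, blast\<close>)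
  \<comment> \<open>A unimodular vector is not divisible by \<open>\<pi>\<close>, as \<open>\<pi>\<close> is not a unit.\<close>
  have "carrier ?Q \<noteq> {\<zero>\<^bsub>?Q\<^esub>}"
  proof
    assume triv: "carrier ?Q = {\<zero>\<^bsub>?Q\<^esub>}"
    obtain u where "u \<in> carrier U" "u \<noteq> \<zero>\<^bsub>U\<^esub>" using nonzero U.M.zero_closed by blast
    then obtain w f where w: "w \<in> carrier U" and f: "f \<in> functionals R V" "f w = \<one>\<^bsub>R\<^esub>"
      using factor by blast
    have "?N +>\<^bsub>U\<^esub> w \<in> carrier ?Q" using w carr by auto
    then have "w \<in> ?N" using triv zero coset_zero[OF w] by auto
    then obtain v where v: "v \<in> carrier U" "w = \<pi> \<odot>\<^bsub>V\<^esub> v" by auto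
    have fv: "f v \<in> carrier R" using V.functionalD(2)[OF f(1)] v by simp
    have "\<one>\<^bsub>R\<^esub> = f v \<otimes>\<^bsub>R\<^esub> \<pi>"
      using V.functionalD(4)[OF f(1) \<pi>] f(2) v fv \<pi> by (simp add: A.R.m_comm)
    then have "\<one>\<^bsub>R\<^esub> \<in> PIdl\<^bsub>R\<^esub> \<pi>" using fv unfolding cgenideal_def by blast
    then show False using max.one_imp_carrier max.I_notcarr by auto
  qed
  moreover have "T = {\<zero>\<^bsub>?Q\<^esub>} \<or> T = carrier ?Q" if T: "submodule T (?S Quot ?I) ?Q" for T
  proof (rule disjCI)
    interpret T: submodule T "?S Quot ?I" ?Q by (fact T)
    assume "T \<noteq> carrier ?Q"
    moreover have "carrier ?Q \<subseteq> T" if C: "C \<in> T" "C \<noteq> \<zero>\<^bsub>?Q\<^esub>" for C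
    proof
      obtain u where u: "u \<in> carrier U" "C = ?N +>\<^bsub>U\<^esub> u" using C(1) T.subset carr[of C] by auto
      then have uN: "u \<notin> ?N" using C(2) zero coset_zero by auto
      then have "u \<noteq> \<zero>\<^bsub>U\<^esub>" using N.zero_closed by auto
      then obtain g w f where g: "g \<in> carrier R" and w: "w \<in> carrier U"
        and f: "f \<in> functionals R V" "f w = \<one>\<^bsub>R\<^esub>" and ug: "u = g \<odot>\<^bsub>V\<^esub> w"
        using factor u(1) by blast
      have "g \<notin> PIdl\<^bsub>R\<^esub> \<pi>"
      proof
        assume "g \<in> PIdl\<^bsub>R\<^esub> \<pi>"
        then obtain c where c: "c \<in> carrier R" "g = c \<otimes>\<^bsub>R\<^esub> \<pi>"
          unfolding cgenideal_def by blast
        then have "g = \<pi> \<otimes>\<^bsub>R\<^esub> c" using \<pi> A.R.m_comm by simp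
        then have "u = \<pi> \<odot>\<^bsub>V\<^esub> (c \<odot>\<^bsub>V\<^esub> w)" using ug w \<pi> c(1) V.smult_assoc1[OF \<pi> c(1)] by simp
        then show False using uN c w by auto
      qed
      then obtain c r where c: "c \<in> carrier R" and r: "r \<in> carrier R"
        and one: "\<one>\<^bsub>R\<^esub> = c \<otimes>\<^bsub>R\<^esub> \<pi> \<oplus>\<^bsub>R\<^esub> r \<otimes>\<^bsub>R\<^esub> g"
        using A.R.maximal_principal_ideal_comaximal[OF max \<pi> g] by blast
      fix D assume "D \<in> carrier ?Q"
      then obtain v where v: "v \<in> carrier U" "D = ?N +>\<^bsub>U\<^esub> v" using carr by auto
      obtain a where a: "a \<in> carrier A" "v = a \<odot>\<^bsub>U\<^esub> w" using generates[OF f(1) w f(2) v(1)] by blast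
      have "v = \<one>\<^bsub>R\<^esub> \<odot>\<^bsub>V\<^esub> v" using V.smult_one v by simp
      also have "\<dots> = (c \<otimes>\<^bsub>R\<^esub> \<pi>) \<odot>\<^bsub>V\<^esub> v \<oplus>\<^bsub>U\<^esub> (r \<otimes>\<^bsub>R\<^esub> g) \<odot>\<^bsub>V\<^esub> v"
        unfolding one using V.smult_l_distr v c \<pi> r g by simp
      also have "(c \<otimes>\<^bsub>R\<^esub> \<pi>) \<odot>\<^bsub>V\<^esub> v = \<pi> \<odot>\<^bsub>V\<^esub> (c \<odot>\<^bsub>V\<^esub> v)"
        using V.smult_assoc1[OF \<pi> c] A.R.m_comm[OF c \<pi>] v by simp
      also have "(r \<otimes>\<^bsub>R\<^esub> g) \<odot>\<^bsub>V\<^esub> v = (r \<odot>\<^bsub>A\<^esub> a) \<odot>\<^bsub>U\<^esub> u"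
        using V.smult_assoc1[OF g r] A.R.m_comm[OF r g] a w r g ug by (simp add: act_smult_left act_smult_right)
      finally have "v \<in> ?N +>\<^bsub>U\<^esub> ((r \<odot>\<^bsub>A\<^esub> a) \<odot>\<^bsub>U\<^esub> u)"
        using c v(1) by (auto simp: a_r_coset_def')
      then have "D = ?N +>\<^bsub>U\<^esub> ((r \<odot>\<^bsub>A\<^esub> a) \<odot>\<^bsub>U\<^esub> u)"
        using N.a_repr_independence'[of v] r a u v by auto
      also have "\<dots> = (?I +>\<^bsub>?S\<^esub> (r \<odot>\<^bsub>A\<^esub> a)) \<odot>\<^bsub>?Q\<^esub> C"
        using sm[of "r \<odot>\<^bsub>A\<^esub> a" u] r a u by simp
      also have "\<dots> \<in> T"
      proof (rule T.smult_closed[OF _ C(1)])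
        show "?I +>\<^bsub>?S\<^esub> (r \<odot>\<^bsub>A\<^esub> a) \<in> carrier (?S Quot ?I)"
          using r a by (auto simp: FactRing_def A_RCOSETS_def')
      qed
      finally show "D \<in> T" .
    qed
    ultimately show "T = {\<zero>\<^bsub>?Q\<^esub>}" using T.subset T.one_closed by auto
  qed
  ultimately show ?thesis using Q unfolding simple_module_def by blast
qed

end

section \<open>Extension of scalars to the field of fractions\<close>

lemma ring_as_module_simps [simp]:
  "carrier (ring_as_module K \<iota>) = carrier K"
  "add (ring_as_module K \<iota>) = add K"
  "module.smult (ring_as_module K \<iota>) = (\<lambda>r x. \<iota> r \<otimes>\<^bsub>K\<^esub> x)"
  by (simp_all add: ring_as_module_def)

lemma frag_extend_add_fun: "frag_extend (\<lambda>x. b x + c x) f = frag_extend b f + frag_extend c f"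
  by (simp add: frag_extend_def frag_cmul_distrib2 sum.distrib)

lemma frag_extend_diff_fun: "frag_extend (\<lambda>x. b x - c x) f = frag_extend b f - frag_extend c f"
proof -
  have "frag_extend b f = frag_extend (\<lambda>x. b x - c x) f + frag_extend c f"
    using frag_extend_add_fun[of "\<lambda>x. b x - c x" c f] by simp
  then show ?thesis by simp
qed

lemma frag_extend2_simps [simp]:
  "frag_extend2 \<beta> (frag_of s) (frag_of t) = frag_of (\<beta> s t)"
  "frag_extend2 \<beta> 0 g = 0"
  "frag_extend2 \<beta> f 0 = 0"
  "frag_extend2 \<beta> (f - f') g = frag_extend2 \<beta> f g - frag_extend2 \<beta> f' g"
  "frag_extend2 \<beta> f (g - g') = frag_extend2 \<beta> f g - frag_extend2 \<beta> f g'"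
  by (simp_all add: frag_extend2_def frag_extend_diff frag_extend_diff_fun frag_extend_eq_0)

locale scalar_extension = module R M
  for R :: "'r ring" and M :: "('r, 'b) module" +
  fixes K :: "'k ring" and \<iota> :: "'r \<Rightarrow> 'k"
  assumes fractions: "fraction_field R K \<iota>"
begin

sublocale K: field K using fractions by (simp add: fraction_field_def)

sublocale \<iota>: ring_hom_ring R K \<iota>
  using fractions R.ring_axioms K.ring_axioms
  by (auto simp: fraction_field_def ring_hom_ring_def ring_hom_ring_axioms_def)

abbreviation G where "G \<equiv> free_Abelian_group (carrier K \<times> carrier M)"
abbreviation Ker where "Ker \<equiv> tensor_kernel R (ring_as_module K \<iota>) M"
abbreviation T where "T \<equiv> tensor_product R (ring_as_module K \<iota>) M"
abbreviation cls where "cls \<equiv> tensor_class R (ring_as_module K \<iota>) M"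
abbreviation pure_tensor where "pure_tensor x u \<equiv> cls (frag_of (x, u))"

lemma relations_closed: "tensor_relations R (ring_as_module K \<iota>) M \<subseteq> carrier G"
  by (auto simp: tensor_relations_def dest!: subsetD[OF keys_diff])

lemma Ker_subgroup: "subgroup Ker G"
  unfolding tensor_kernel_def ring_as_module_simps
  by (rule group.generate_is_subgroup[OF group_free_Abelian_group relations_closed])

sublocale Ker: normal Ker G
  by (rule comm_group.subgroup_imp_normal[OF abelian_free_Abelian_group Ker_subgroup])

lemma Ker_closed: "f \<in> Ker \<Longrightarrow> f \<in> carrier G" using subgroup.subset[OF Ker_subgroup] by blast

lemma Ker_zero: "0 \<in> Ker" and Ker_add: "f \<in> Ker \<Longrightarrow> g \<in> Ker \<Longrightarrow> f + g \<in> Ker"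
  and Ker_minus: "f \<in> Ker \<Longrightarrow> - f \<in> Ker"
  and Ker_diff: "f \<in> Ker \<Longrightarrow> g \<in> Ker \<Longrightarrow> f - g \<in> Ker"
proof -
  show 0: "0 \<in> Ker" using subgroup.one_closed[OF Ker_subgroup] by simp
  show a: "f + g \<in> Ker" if "f \<in> Ker" "g \<in> Ker" for f g using subgroup.m_closed[OF Ker_subgroup that] by simp
  show m: "- f \<in> Ker" if "f \<in> Ker" for f
    using subgroup.m_inv_closed[OF Ker_subgroup that] Ker_closed[OF that] by simp
  show "f - g \<in> Ker" if "f \<in> Ker" "g \<in> Ker" for f g
    using a[OF that(1) m[OF that(2)]] by simp
qed

lemma relation_add_left: "\<lbrakk>x \<in> carrier K; x' \<in> carrier K; u \<in> carrier M\<rbrakk> \<Longrightarrow>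
    frag_of (x \<oplus>\<^bsub>K\<^esub> x', u) - frag_of (x, u) - frag_of (x', u) \<in> Ker"
  unfolding tensor_kernel_def by (rule generate.incl) (auto simp: tensor_relations_def)

lemma relation_add_right: "\<lbrakk>x \<in> carrier K; u \<in> carrier M; u' \<in> carrier M\<rbrakk> \<Longrightarrow>
    frag_of (x, u \<oplus>\<^bsub>M\<^esub> u') - frag_of (x, u) - frag_of (x, u') \<in> Ker"
  unfolding tensor_kernel_def by (rule generate.incl) (auto simp: tensor_relations_def)

lemma relation_smult: "\<lbrakk>r \<in> carrier R; x \<in> carrier K; u \<in> carrier M\<rbrakk> \<Longrightarrow>
    frag_of (\<iota> r \<otimes>\<^bsub>K\<^esub> x, u) - frag_of (x, r \<odot>\<^bsub>M\<^esub> u) \<in> Ker"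
  unfolding tensor_kernel_def by (rule generate.incl) (auto simp: tensor_relations_def)

text \<open>
  A subgroup is closed under differences, so one closure step replaces the separate steps for products and
  inverses.
\<close>

lemma Ker_induct [consumes 1, case_names add_left add_right smult zero diff]:
  assumes "f \<in> Ker"
    and "\<And>x x' u. \<lbrakk>x \<in> carrier K; x' \<in> carrier K; u \<in> carrier M\<rbrakk> \<Longrightarrow>
           P (frag_of (x \<oplus>\<^bsub>K\<^esub> x', u) - frag_of (x, u) - frag_of (x', u))"
    and "\<And>x u u'. \<lbrakk>x \<in> carrier K; u \<in> carrier M; u' \<in> carrier M\<rbrakk> \<Longrightarrow>
           P (frag_of (x, u \<oplus>\<^bsub>M\<^esub> u') - frag_of (x, u) - frag_of (x, u'))"
    and "\<And>r x u. \<lbrakk>r \<in> carrier R; x \<in> carrier K; u \<in> carrier M\<rbrakk> \<Longrightarrow>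
           P (frag_of (\<iota> r \<otimes>\<^bsub>K\<^esub> x, u) - frag_of (x, r \<odot>\<^bsub>M\<^esub> u))"
    and zero: "P 0"
    and diff: "\<And>f g. \<lbrakk>f \<in> carrier G; g \<in> carrier G; P f; P g\<rbrakk> \<Longrightarrow> P (f - g)"
  shows "P f"
proof -
  have gen: "f \<in> generate G (tensor_relations R (ring_as_module K \<iota>) M)"
    using assms(1) by (simp add: tensor_kernel_def)
  have rel: "P h" if "h \<in> tensor_relations R (ring_as_module K \<iota>) M" for h
    using that assms(2-4) unfolding tensor_relations_def by auto
  have "f \<in> carrier G \<and> P f"
    using gen
  proof (induction rule: generate.induct)
    case one
    then show ?case using zero by simp
  next
    case (incl h)
    then show ?case using rel relations_closed by blast
  next
    case (inv h)
    then have "h \<in> carrier G" using relations_closed by blast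
    moreover then have "P (0 - h)" by (intro diff zero rel inv) auto
    ultimately show ?case by (simp add: keys_minus)
  next
    case (eng h1 h2)
    then have c: "h1 \<in> carrier G" "h2 \<in> carrier G" by auto
    then have "P (0 - h2)" using eng zero by (intro diff) auto
    then have "P (h1 - (0 - h2))" using eng c zero by (intro diff) (auto simp: keys_minus)
    then show ?case using c keys_add[of h1 h2] by auto
  qed
  then show ?thesis ..
qed

lemma T_comm_group: "comm_group T"
  unfolding tensor_product_def ring_as_module_simps
  by (rule comm_group.abelian_FactGroup[OF abelian_free_Abelian_group Ker_subgroup])

sublocale T: comm_group T by (rule T_comm_group)

lemma T_carrier: "C \<in> carrier T \<longleftrightarrow> (\<exists>f\<in>carrier G. C = cls f)"
  by (auto simp: tensor_product_def FactGroup_def RCOSETS_def tensor_class_def)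

lemma T_one: "\<one>\<^bsub>T\<^esub> = Ker"
  by (simp add: tensor_product_def FactGroup_def)

lemma cls_closed [simp]: "f \<in> carrier G \<Longrightarrow> cls f \<in> carrier T"
  using T_carrier by blast

lemma cls_self: "f \<in> carrier G \<Longrightarrow> f \<in> cls f"
  unfolding tensor_class_def ring_as_module_simps using Ker.rcos_self[OF _ Ker_subgroup] by simp

lemma cls_member: "f \<in> carrier G \<Longrightarrow> g \<in> cls f \<longleftrightarrow> g - f \<in> Ker"
proof -
  have "g \<in> cls f \<longleftrightarrow> (\<exists>h\<in>Ker. g = h + f)"
    unfolding tensor_class_def by (simp add: r_coset_def)
  also have "\<dots> \<longleftrightarrow> g - f \<in> Ker" by (auto intro: bexI[of _ "g - f"])
  finally show ?thesis .
qed

lemma cls_member_closed: "f \<in> carrier G \<Longrightarrow> g \<in> cls f \<Longrightarrow> g \<in> carrier G"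
  using Ker_closed[of "g - f"] keys_add[of "g - f" f] by (auto simp: cls_member)

lemma cls_eqI:
  assumes "f \<in> carrier G" "g \<in> carrier G" "f - g \<in> Ker"
  shows "cls f = cls g"
proof -
  have "h - f \<in> Ker \<longleftrightarrow> h - g \<in> Ker" for h
    using Ker_add[of "h - f" "f - g"] Ker_diff[of "h - g" "f - g"] assms(3) by auto
  then show ?thesis using cls_member assms by blast
qed

lemma cls_add:
  assumes "f \<in> carrier G" "g \<in> carrier G"
  shows "cls f \<otimes>\<^bsub>T\<^esub> cls g = cls (f + g)"
  using Ker.rcos_sum[OF assms] by (simp add: tensor_product_def FactGroup_def tensor_class_def)

lemma cls_zero: "cls 0 = \<one>\<^bsub>T\<^esub>"
  using cls_member[of 0] by (auto simp: T_one)

lemma pure_tensor_closed [simp]: "x \<in> carrier K \<Longrightarrow> u \<in> carrier M \<Longrightarrow> pure_tensor x u \<in> carrier T"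
  by simp

lemma pure_tensor_add_left:
  assumes "x \<in> carrier K" "x' \<in> carrier K" "u \<in> carrier M"
  shows "pure_tensor (x \<oplus>\<^bsub>K\<^esub> x') u = pure_tensor x u \<otimes>\<^bsub>T\<^esub> pure_tensor x' u"
proof -
  have "cls (frag_of (x \<oplus>\<^bsub>K\<^esub> x', u)) = cls (frag_of (x, u) + frag_of (x', u))"
    by (rule cls_eqI)
      (use relation_add_left[OF assms] assms keys_add[of "frag_of (x, u)" "frag_of (x', u)"]
        in \<open>auto simp: diff_diff_eq\<close>)
  then show ?thesis using assms by (simp add: cls_add)
qed

lemma pure_tensor_add_right:
  assumes "x \<in> carrier K" "u \<in> carrier M" "u' \<in> carrier M"
  shows "pure_tensor x (u \<oplus>\<^bsub>M\<^esub> u') = pure_tensor x u \<otimes>\<^bsub>T\<^esub> pure_tensor x u'"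
proof -
  have "cls (frag_of (x, u \<oplus>\<^bsub>M\<^esub> u')) = cls (frag_of (x, u) + frag_of (x, u'))"
    by (rule cls_eqI)
      (use relation_add_right[OF assms] assms keys_add[of "frag_of (x, u)" "frag_of (x, u')"]
        in \<open>auto simp: diff_diff_eq\<close>)
  then show ?thesis using assms by (simp add: cls_add)
qed

lemma pure_tensor_smult:
  assumes "r \<in> carrier R" "x \<in> carrier K" "u \<in> carrier M"
  shows "pure_tensor (\<iota> r \<otimes>\<^bsub>K\<^esub> x) u = pure_tensor x (r \<odot>\<^bsub>M\<^esub> u)"
  by (rule cls_eqI) (use relation_smult[OF assms] assms in auto)

lemma pure_tensor_zero_left: "u \<in> carrier M \<Longrightarrow> pure_tensor \<zero>\<^bsub>K\<^esub> u = \<one>\<^bsub>T\<^esub>"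
  using pure_tensor_add_left[of "\<zero>\<^bsub>K\<^esub>" "\<zero>\<^bsub>K\<^esub>" u] T.l_cancel_one'[of "pure_tensor \<zero>\<^bsub>K\<^esub> u" "pure_tensor \<zero>\<^bsub>K\<^esub> u"] by simp

lemma pure_tensor_zero_right: "x \<in> carrier K \<Longrightarrow> pure_tensor x \<zero>\<^bsub>M\<^esub> = \<one>\<^bsub>T\<^esub>"
  using pure_tensor_add_right[of x "\<zero>\<^bsub>M\<^esub>" "\<zero>\<^bsub>M\<^esub>"] T.l_cancel_one'[of "pure_tensor x \<zero>\<^bsub>M\<^esub>" "pure_tensor x \<zero>\<^bsub>M\<^esub>"] by simp

lemma common_denominator:
  assumes "x \<in> carrier K" "y \<in> carrier K"
  obtains a b c where "a \<in> carrier R" "b \<in> carrier R" "c \<in> carrier K"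
    "x = \<iota> a \<otimes>\<^bsub>K\<^esub> c" "y = \<iota> b \<otimes>\<^bsub>K\<^esub> c"
proof -
  have inj: "inj_on \<iota> (carrier R)" using fractions by (simp add: fraction_field_def)
  have fr: "\<exists>a\<in>carrier R. \<exists>b\<in>carrier R. \<iota> b \<noteq> \<zero>\<^bsub>K\<^esub> \<and> x = \<iota> a \<otimes>\<^bsub>K\<^esub> inv\<^bsub>K\<^esub> (\<iota> b)" if "x \<in> carrier K" for x
  proof -
    obtain a b where ab: "a \<in> carrier R" "b \<in> carrier R" "b \<noteq> \<zero>\<^bsub>R\<^esub>" "x = \<iota> a \<otimes>\<^bsub>K\<^esub> inv\<^bsub>K\<^esub> (\<iota> b)"
      using fractions \<open>x \<in> carrier K\<close> unfolding fraction_field_def by blast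
    moreover have "\<iota> b \<noteq> \<iota> \<zero>\<^bsub>R\<^esub>"
      using ab(2,3) inj_onD[OF inj, of b "\<zero>\<^bsub>R\<^esub>"] by blast
    ultimately show ?thesis by auto
  qed
  obtain a b where a: "a \<in> carrier R" "b \<in> carrier R" "\<iota> b \<noteq> \<zero>\<^bsub>K\<^esub>" "x = \<iota> a \<otimes>\<^bsub>K\<^esub> inv\<^bsub>K\<^esub> (\<iota> b)"
    using fr[OF assms(1)] by blast
  obtain a' b' where a': "a' \<in> carrier R" "b' \<in> carrier R" "\<iota> b' \<noteq> \<zero>\<^bsub>K\<^esub>" "y = \<iota> a' \<otimes>\<^bsub>K\<^esub> inv\<^bsub>K\<^esub> (\<iota> b')"
    using fr[OF assms(2)] by blast
  have u: "\<iota> b \<in> Units K" "\<iota> b' \<in> Units K" using a a' K.field_Units by auto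
  let ?c = "inv\<^bsub>K\<^esub> (\<iota> b) \<otimes>\<^bsub>K\<^esub> inv\<^bsub>K\<^esub> (\<iota> b')"
  have swap: "(k \<otimes>\<^bsub>K\<^esub> l) \<otimes>\<^bsub>K\<^esub> (m \<otimes>\<^bsub>K\<^esub> n) = (k \<otimes>\<^bsub>K\<^esub> m) \<otimes>\<^bsub>K\<^esub> (l \<otimes>\<^bsub>K\<^esub> n)"
    if "k \<in> carrier K" "l \<in> carrier K" "m \<in> carrier K" "n \<in> carrier K" for k l m n
    using that by (simp add: K.m_ac)
  have x: "x = \<iota> (a \<otimes>\<^bsub>R\<^esub> b') \<otimes>\<^bsub>K\<^esub> ?c"
    using swap[of "\<iota> a" "\<iota> b'" "inv\<^bsub>K\<^esub> (\<iota> b)" "inv\<^bsub>K\<^esub> (\<iota> b')"] a a' u by simp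
  have y: "y = \<iota> (a' \<otimes>\<^bsub>R\<^esub> b) \<otimes>\<^bsub>K\<^esub> ?c"
    using swap[of "\<iota> a'" "\<iota> b" "inv\<^bsub>K\<^esub> (\<iota> b')" "inv\<^bsub>K\<^esub> (\<iota> b)"]
      K.m_comm[of "inv\<^bsub>K\<^esub> (\<iota> b)" "inv\<^bsub>K\<^esub> (\<iota> b')"] a a' u by simp
  show ?thesis using that[OF _ _ _ x y] a a' u by simp
qed

lemma pure_tensors_common:
  assumes "x \<in> carrier K" "y \<in> carrier K" "u \<in> carrier M" "v \<in> carrier M"
  obtains c u' v' where "c \<in> carrier K" "u' \<in> carrier M" "v' \<in> carrier M"
    "pure_tensor x u = pure_tensor c u'" "pure_tensor y v = pure_tensor c v'"
proof -
  obtain a b c where "a \<in> carrier R" "b \<in> carrier R" "c \<in> carrier K"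
    "x = \<iota> a \<otimes>\<^bsub>K\<^esub> c" "y = \<iota> b \<otimes>\<^bsub>K\<^esub> c"
    using common_denominator[OF assms(1,2)] .
  then show ?thesis
    using that[of c "a \<odot>\<^bsub>M\<^esub> u" "b \<odot>\<^bsub>M\<^esub> v"] assms(3,4) pure_tensor_smult by simp
qed

text \<open>
  Over a common denominator \<open>c\<close>, two pure tensors become \<open>c \<otimes> u\<close> and \<open>c \<otimes> v\<close>, with difference
  \<open>c \<otimes> (u - v)\<close>. This reduces all later computations to pure tensors.
\<close>

lemma all_tensors_pure:
  assumes "C \<in> carrier T"
  obtains x u where "x \<in> carrier K" "u \<in> carrier M" "C = pure_tensor x u"
proof -
  obtain f where f: "f \<in> carrier G" "C = cls f" using assms T_carrier by blast
  have "\<exists>x\<in>carrier K. \<exists>u\<in>carrier M. cls f = pure_tensor x u"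
    using f(1)[unfolded carrier_free_Abelian_group_iff]
  proof (induction f rule: free_Abelian_group_induct[consumes 1, case_names zero diff generator])
    case zero
    then show ?case
      using pure_tensor_zero_left[OF M.zero_closed] cls_zero by (metis K.zero_closed M.zero_closed)
  next
    case (diff f g)
    then obtain x u y v where xy: "x \<in> carrier K" "u \<in> carrier M" "cls f = pure_tensor x u"
        "y \<in> carrier K" "v \<in> carrier M" "cls g = pure_tensor y v" by blast
    obtain c u' v' where c: "c \<in> carrier K" "u' \<in> carrier M" "v' \<in> carrier M"
      "pure_tensor x u = pure_tensor c u'" "pure_tensor y v = pure_tensor c v'"
      using pure_tensors_common[OF xy(1,4,2,5)] .
    have fg: "f - g \<in> carrier G" using diff keys_diff[of f g] by auto
    have "cls (f - g) \<otimes>\<^bsub>T\<^esub> pure_tensor c v' = pure_tensor c u'"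
      using cls_add[OF fg, of g] diff(2) xy c by simp
    also have "\<dots> = pure_tensor c (u' \<ominus>\<^bsub>M\<^esub> v') \<otimes>\<^bsub>T\<^esub> pure_tensor c v'"
      using c by (subst pure_tensor_add_right[symmetric]) (auto simp: a_minus_def M.a_assoc M.l_neg)
    finally have "cls (f - g) = pure_tensor c (u' \<ominus>\<^bsub>M\<^esub> v')"
      using T.r_cancel[of "pure_tensor c v'" "cls (f - g)" "pure_tensor c (u' \<ominus>\<^bsub>M\<^esub> v')"] c fg by simp
    then show ?case using c by blast
  next
    case (generator a)
    then show ?case by auto
  qed
  then show ?thesis using that f(2) by blast
qed

text \<open>
  The map \<open>x \<otimes> u \<mapsto> x \<iota>(f(u))\<close> to \<open>K\<close> respects the relations and sends \<open>1 \<otimes> w\<close> to \<open>1\<close>.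
\<close>

lemma pure_tensor_nonzero:
  assumes f: "f \<in> functionals R M" and w: "w \<in> carrier M" "f w = \<one>\<^bsub>R\<^esub>"
  shows "pure_tensor \<one>\<^bsub>K\<^esub> w \<noteq> \<one>\<^bsub>T\<^esub>"
proof
  assume "pure_tensor \<one>\<^bsub>K\<^esub> w = \<one>\<^bsub>T\<^esub>"
  then have kw: "frag_of (\<one>\<^bsub>K\<^esub>, w) \<in> Ker" using cls_self[of "frag_of (\<one>\<^bsub>K\<^esub>, w)"] w T_one by simp
  have fc: "f u \<in> carrier R" if "u \<in> carrier M" for u using f that by (auto simp: module_homs_def)
  have fa: "f (u \<oplus>\<^bsub>M\<^esub> v) = f u \<oplus>\<^bsub>R\<^esub> f v" if "u \<in> carrier M" "v \<in> carrier M" for u v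
    using f that by (auto simp: module_homs_def)
  have fs: "f (r \<odot>\<^bsub>M\<^esub> u) = r \<otimes>\<^bsub>R\<^esub> f u" if "u \<in> carrier M" "r \<in> carrier R" for u r
    using f that by (auto simp: module_homs_def)
  have KG: "comm_group (add_monoid K)" by (rule K.a_comm_group)
  obtain h where h: "h \<in> hom G (add_monoid K)"
    and h_of: "\<And>p. p \<in> carrier K \<times> carrier M \<Longrightarrow> h (frag_of p) = (case p of (x, u) \<Rightarrow> x \<otimes>\<^bsub>K\<^esub> \<iota> (f u))"
    by (rule comm_group.free_Abelian_group_universal[OF KG, of "\<lambda>(x, u). x \<otimes>\<^bsub>K\<^esub> \<iota> (f u)" "carrier K \<times> carrier M"])
      (use fc in auto)
  have hp: "h (frag_of (x, u)) = x \<otimes>\<^bsub>K\<^esub> \<iota> (f u)" if "x \<in> carrier K" "u \<in> carrier M" for x u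
    using h_of[of "(x, u)"] that by simp
  have hc: "h g \<in> carrier K" if "g \<in> carrier G" for g using hom_in_carrier[OF h that] by simp
  have hadd: "h (g + g') = h g \<oplus>\<^bsub>K\<^esub> h g'" if "g \<in> carrier G" "g' \<in> carrier G" for g g'
    using hom_mult[OF h that] by simp
  have hdiff: "h (g - g') = h g \<ominus>\<^bsub>K\<^esub> h g'" if g: "g \<in> carrier G" "g' \<in> carrier G" for g g'
  proof -
    have d: "g - g' \<in> carrier G" using g keys_diff[of g g'] by auto
    have "h g = h (g - g') \<oplus>\<^bsub>K\<^esub> h g'" using hadd[OF d g(2)] by simp
    then show ?thesis using hc[OF d] hc[OF g(2)] by (simp add: a_minus_def K.a_assoc K.r_neg)
  qed
  have d: "frag_of p - frag_of q \<in> carrier G" if "p \<in> carrier K \<times> carrier M" "q \<in> carrier K \<times> carrier M" for p q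
    using that keys_diff[of "frag_of p" "frag_of q"] by auto
  have cancel: "(a \<oplus>\<^bsub>K\<^esub> b) \<ominus>\<^bsub>K\<^esub> a = b" if "a \<in> carrier K" "b \<in> carrier K" for a b
    using that by (simp add: a_minus_def K.a_comm[of a b] K.a_assoc K.r_neg)
  \<comment> \<open>\<open>h\<close> vanishes on the relations, hence on all of \<open>Ker\<close>.\<close>
  from kw have "h (frag_of (\<one>\<^bsub>K\<^esub>, w)) = \<zero>\<^bsub>K\<^esub>"
  proof (induction rule: Ker_induct)
    case (add_left x x' u)
    then show ?case using fc d hp
      by (simp add: hdiff del: carrier_free_Abelian_group_iff, simp add: hdiff K.l_distr cancel)
  next
    case (add_right x u u')
    then show ?case using fc d hp
      by (simp add: hdiff del: carrier_free_Abelian_group_iff, simp add: hdiff K.r_distr fa cancel)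
  next
    case (smult r x u)
    then show ?case using fc hp by (simp add: hdiff fs K.m_ac a_minus_def K.r_neg)
  next
    case zero
    show ?case using hdiff[of 0 0] hc[of 0] by (simp add: a_minus_def K.r_neg)
  next
    case (diff f g)
    then show ?case by (simp add: hdiff del: carrier_free_Abelian_group_iff)
  qed
  then show False using hp w by simp
qed

end

text \<open>
  Common setting for the multiplication of \<open>K \<otimes> A\<close> and for its action on \<open>K \<otimes> U\<close>: a bilinear map \<open>\<mu>\<close> from \<open>L\<close> and
  \<open>M\<close> to \<open>N\<close> induces \<open>(x \<otimes> a, y \<otimes> u) \<mapsto> x y \<otimes> \<mu> a u\<close>.
\<close>

locale bilinear_extension =
  L: scalar_extension R L K \<iota> + M: scalar_extension R M K \<iota> + N: scalar_extension R N K \<iota>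
  for R :: "'r ring" and L :: "('r, 'a) module" and M :: "('r, 'b) module" and N :: "('r, 'c) module"
    and K :: "'k ring" and \<iota> :: "'r \<Rightarrow> 'k" +
  fixes \<mu> :: "'a \<Rightarrow> 'b \<Rightarrow> 'c"
  assumes \<mu>_closed: "\<lbrakk>a \<in> carrier L; u \<in> carrier M\<rbrakk> \<Longrightarrow> \<mu> a u \<in> carrier N"
    and \<mu>_add_left: "\<lbrakk>a \<in> carrier L; b \<in> carrier L; u \<in> carrier M\<rbrakk> \<Longrightarrow> \<mu> (a \<oplus>\<^bsub>L\<^esub> b) u = \<mu> a u \<oplus>\<^bsub>N\<^esub> \<mu> b u"
    and \<mu>_add_right: "\<lbrakk>a \<in> carrier L; u \<in> carrier M; v \<in> carrier M\<rbrakk> \<Longrightarrow> \<mu> a (u \<oplus>\<^bsub>M\<^esub> v) = \<mu> a u \<oplus>\<^bsub>N\<^esub> \<mu> a v"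
    and \<mu>_smult_left: "\<lbrakk>r \<in> carrier R; a \<in> carrier L; u \<in> carrier M\<rbrakk> \<Longrightarrow> \<mu> (r \<odot>\<^bsub>L\<^esub> a) u = r \<odot>\<^bsub>N\<^esub> \<mu> a u"
    and \<mu>_smult_right: "\<lbrakk>r \<in> carrier R; a \<in> carrier L; u \<in> carrier M\<rbrakk> \<Longrightarrow> \<mu> a (r \<odot>\<^bsub>M\<^esub> u) = r \<odot>\<^bsub>N\<^esub> \<mu> a u"
begin

abbreviation \<beta> where "\<beta> \<equiv> (\<lambda>(x, a) (y, u). (x \<otimes>\<^bsub>K\<^esub> y, \<mu> a u))"

lemma extend2_carrier:
  assumes "f \<in> carrier L.G" "g \<in> carrier M.G"
  shows "frag_extend2 \<beta> f g \<in> carrier N.G"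
  using assms(1)[unfolded carrier_free_Abelian_group_iff]
proof (induction f rule: free_Abelian_group_induct[consumes 1, case_names zero diff generator])
  case zero
  then show ?case by simp
next
  case (diff f f')
  then show ?case
    using keys_diff[of "frag_extend2 \<beta> f g" "frag_extend2 \<beta> f' g"] by auto
next
  case (generator p)
  show ?case using assms(2)[unfolded carrier_free_Abelian_group_iff]
  proof (induction g rule: free_Abelian_group_induct[consumes 1, case_names zero diff generator])
    case zero
    then show ?case by simp
  next
    case (diff g g')
    then show ?case
      using keys_diff[of "frag_extend2 \<beta> (frag_of p) g" "frag_extend2 \<beta> (frag_of p) g'"] by auto
  next
    case (generator q)
    then show ?case using \<open>p \<in> carrier K \<times> carrier L\<close> \<mu>_closed by auto
  qed
qed

text \<open>
  Against a generator \<open>(y, u)\<close>, each defining relation becomes a defining relation of the same kind.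
\<close>

lemma extend2_Ker_left:
  assumes f: "f \<in> L.Ker" and g: "g \<in> carrier M.G"
  shows "frag_extend2 \<beta> f g \<in> N.Ker"
  using g[unfolded carrier_free_Abelian_group_iff]
proof (induction g rule: free_Abelian_group_induct[consumes 1, case_names zero diff generator])
  case zero
  then show ?case by (simp add: N.Ker_zero)
next
  case (diff g g')
  then show ?case by (simp add: N.Ker_diff)
next
  case (generator q)
  then obtain y u where q: "q = (y, u)" "y \<in> carrier K" "u \<in> carrier M" by auto
  show ?case using f
  proof (induction rule: L.Ker_induct)
    case (add_left x x' a)
    then show ?case
      using q N.relation_add_left[of "x \<otimes>\<^bsub>K\<^esub> y" "x' \<otimes>\<^bsub>K\<^esub> y" "\<mu> a u"] \<mu>_closed
      by (simp add: L.K.l_distr)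
  next
    case (add_right x a a')
    then show ?case
      using q N.relation_add_right[of "x \<otimes>\<^bsub>K\<^esub> y" "\<mu> a u" "\<mu> a' u"] \<mu>_closed
      by (simp add: \<mu>_add_left)
  next
    case (smult r x a)
    then show ?case
      using q N.relation_smult[of r "x \<otimes>\<^bsub>K\<^esub> y" "\<mu> a u"] \<mu>_closed
      by (simp add: \<mu>_smult_left L.K.m_assoc)
  next
    case zero
    then show ?case by (simp add: N.Ker_zero)
  next
    case (diff f f')
    then show ?case by (simp add: N.Ker_diff)
  qed
qed

lemma extend2_Ker_right:
  assumes f: "f \<in> carrier L.G" and g: "g \<in> M.Ker"
  shows "frag_extend2 \<beta> f g \<in> N.Ker"
  using f[unfolded carrier_free_Abelian_group_iff]
proof (induction f rule: free_Abelian_group_induct[consumes 1, case_names zero diff generator])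
  case zero
  then show ?case by (simp add: N.Ker_zero)
next
  case (diff f f')
  then show ?case by (simp add: N.Ker_diff)
next
  case (generator p)
  then obtain x a where p: "p = (x, a)" "x \<in> carrier K" "a \<in> carrier L" by auto
  show ?case using g
  proof (induction rule: M.Ker_induct)
    case (add_left y y' u)
    then show ?case
      using p N.relation_add_left[of "x \<otimes>\<^bsub>K\<^esub> y" "x \<otimes>\<^bsub>K\<^esub> y'" "\<mu> a u"] \<mu>_closed
      by (simp add: L.K.r_distr)
  next
    case (add_right y u u')
    then show ?case
      using p N.relation_add_right[of "x \<otimes>\<^bsub>K\<^esub> y" "\<mu> a u" "\<mu> a u'"] \<mu>_closed
      by (simp add: \<mu>_add_right)
  next
    case (smult r y u)
    then show ?case
      using p N.relation_smult[of r "x \<otimes>\<^bsub>K\<^esub> y" "\<mu> a u"] \<mu>_closed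
      by (simp add: \<mu>_smult_right L.K.m_lcomm)
  next
    case zero
    then show ?case by (simp add: N.Ker_zero)
  next
    case (diff g g')
    then show ?case by (simp add: N.Ker_diff)
  qed
qed

text \<open>
  The union over representatives is a single coset: by bilinearity, changing \<open>f\<close> and \<open>g\<close> by elements of the
  kernels changes the product by an element of the kernel.
\<close>

lemma coset_product:
  assumes f: "f \<in> carrier L.G" and g: "g \<in> carrier M.G"
  shows "(\<Union>f'\<in>L.cls f. \<Union>g'\<in>M.cls g. N.cls (frag_extend2 \<beta> f' g')) = N.cls (frag_extend2 \<beta> f g)"
proof -
  have eq: "N.cls (frag_extend2 \<beta> f' g') = N.cls (frag_extend2 \<beta> f g)"
    if f': "f' \<in> L.cls f" and g': "g' \<in> M.cls g" for f' g'
  proof -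
    have c: "f' \<in> carrier L.G" "g' \<in> carrier M.G"
      using L.cls_member_closed[OF f f'] M.cls_member_closed[OF g g'] .
    have "frag_extend2 \<beta> f' g' - frag_extend2 \<beta> f g
        = frag_extend2 \<beta> (f' - f) g' + frag_extend2 \<beta> f (g' - g)" by simp
    also have "\<dots> \<in> N.Ker"
      using f' g' c f g L.cls_member[OF f] M.cls_member[OF g]
      by (intro N.Ker_add extend2_Ker_left extend2_Ker_right) blast+
    finally show ?thesis by (intro N.cls_eqI extend2_carrier c f g)
  qed
  have "(\<Union>f'\<in>L.cls f. \<Union>g'\<in>M.cls g. N.cls (frag_extend2 \<beta> f' g'))
      = (\<Union>f'\<in>L.cls f. \<Union>g'\<in>M.cls g. N.cls (frag_extend2 \<beta> f g))"
    by (intro SUP_cong refl eq)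
  also have "\<dots> = N.cls (frag_extend2 \<beta> f g)"
  proof -
    have "L.cls f \<noteq> {}" "M.cls g \<noteq> {}" using L.cls_self[OF f] M.cls_self[OF g] by blast+
    then show ?thesis by (simp only: UN_constant if_False)
  qed
  finally show ?thesis .
qed

lemma pure_product:
  assumes "x \<in> carrier K" "a \<in> carrier L" "y \<in> carrier K" "u \<in> carrier M"
  shows "(\<Union>f\<in>L.pure_tensor x a. \<Union>g\<in>M.pure_tensor y u. N.cls (frag_extend2 \<beta> f g))
    = N.pure_tensor (x \<otimes>\<^bsub>K\<^esub> y) (\<mu> a u)"
  using coset_product[of "frag_of (x, a)" "frag_of (y, u)"] assms by simp

end

locale lattice_extension = algebra_lattice +
  fixes K :: "'k ring" and \<iota>
  assumes frac: "fraction_field R K \<iota>"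
begin

abbreviation EA where "EA \<equiv> extend_algebra R K \<iota> A"
abbreviation EU where "EU \<equiv> extend_module R K \<iota> A U"

sublocale KA: scalar_extension R A K \<iota>
  by (intro scalar_extension.intro scalar_extension_axioms.intro A.module_axioms frac)

sublocale KU: scalar_extension R V K \<iota>
  by (intro scalar_extension.intro scalar_extension_axioms.intro V_module frac)

sublocale AA: bilinear_extension R A A A K \<iota> "\<lambda>a b. a \<otimes>\<^bsub>A\<^esub> b"
  by unfold_locales (auto simp: A.smult_mult_left A.smult_mult_right A.A.l_distr A.A.r_distr)

sublocale AU: bilinear_extension R A V V K \<iota> "\<lambda>a u. a \<odot>\<^bsub>U\<^esub> u"
  by unfold_locales (auto simp: act_add_left act_add_right act_smult_left act_smult_right)

lemma EA_simps:
  "carrier EA = carrier KA.T" "add EA = monoid.mult KA.T" "one EA = KA.pure_tensor \<one>\<^bsub>K\<^esub> \<one>\<^bsub>A\<^esub>"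
  by (simp_all add: extend_algebra_def Let_def)

lemma EU_simps:
  "carrier EU = carrier KU.T" "add EU = monoid.mult KU.T" "ring.zero EU = one KU.T"
  by (simp_all add: extend_module_def Let_def)

lemma EA_mult_pure:
  assumes "x \<in> carrier K" "a \<in> carrier A" "y \<in> carrier K" "b \<in> carrier A"
  shows "KA.pure_tensor x a \<otimes>\<^bsub>EA\<^esub> KA.pure_tensor y b = KA.pure_tensor (x \<otimes>\<^bsub>K\<^esub> y) (a \<otimes>\<^bsub>A\<^esub> b)"
  using AA.pure_product[OF assms] by (simp add: extend_algebra_def Let_def)

lemma EU_smult_pure:
  assumes "x \<in> carrier K" "a \<in> carrier A" "y \<in> carrier K" "u \<in> carrier U"
  shows "KA.pure_tensor x a \<odot>\<^bsub>EU\<^esub> KU.pure_tensor y u = KU.pure_tensor (x \<otimes>\<^bsub>K\<^esub> y) (a \<odot>\<^bsub>U\<^esub> u)"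
  using AU.pure_product[of x a y u] assms by (simp add: extend_module_def Let_def)

lemma EU_abelian_group: "abelian_group EU"
proof (rule abelian_groupI)
  fix C assume C: "C \<in> carrier EU"
  show "\<exists>D\<in>carrier EU. D \<oplus>\<^bsub>EU\<^esub> C = \<zero>\<^bsub>EU\<^esub>"
    using C by (auto simp: EU_simps intro!: bexI[of _ "inv\<^bsub>KU.T\<^esub> C"])
qed (auto simp: EU_simps KU.T.m_ac)

lemma EU_left_module:
  assumes "ring EA"
  shows "left_module (underlying_ring EA) EU"
proof (intro left_module.intro left_module_axioms.intro EU_abelian_group)
  interpret EA: ring EA by (fact assms)
  show "ring (underlying_ring EA)"
  proof (rule ringI)
    show "abelian_group (underlying_ring EA)"
    proof (rule abelian_groupI)
      fix x assume "x \<in> carrier (underlying_ring EA)"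
      then show "\<exists>y\<in>carrier (underlying_ring EA). y \<oplus>\<^bsub>underlying_ring EA\<^esub> x = \<zero>\<^bsub>underlying_ring EA\<^esub>"
        by (auto intro!: bexI[of _ "\<ominus>\<^bsub>EA\<^esub> x"] EA.l_neg)
    qed (auto simp: EA.a_ac)
    show "Group.monoid (underlying_ring EA)"
      by (rule monoidI) (auto simp: EA.m_assoc)
  qed (auto simp: EA.l_distr EA.r_distr)
next
  fix C D assume "C \<in> carrier (underlying_ring EA)" "D \<in> carrier EU"
  then have C: "C \<in> carrier KA.T" and D: "D \<in> carrier KU.T" by (simp_all add: EA_simps EU_simps)
  obtain x a where x: "x \<in> carrier K" "a \<in> carrier A" "C = KA.pure_tensor x a"
    using KA.all_tensors_pure[OF C] .
  obtain y u where y: "y \<in> carrier K" "u \<in> carrier U" "D = KU.pure_tensor y u"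
    using KU.all_tensors_pure[OF D] by auto
  show "C \<odot>\<^bsub>EU\<^esub> D \<in> carrier EU"
    using x y by (simp add: EU_smult_pure EU_simps del: carrier_free_Abelian_group_iff)
next
  fix C C' D assume "C \<in> carrier (underlying_ring EA)" "C' \<in> carrier (underlying_ring EA)" "D \<in> carrier EU"
  then have C: "C \<in> carrier KA.T" and C': "C' \<in> carrier KA.T" and D: "D \<in> carrier KU.T"
    by (simp_all add: EA_simps EU_simps)
  obtain x a where x: "x \<in> carrier K" "a \<in> carrier A" "C = KA.pure_tensor x a"
    using KA.all_tensors_pure[OF C] .
  obtain x' a' where x': "x' \<in> carrier K" "a' \<in> carrier A" "C' = KA.pure_tensor x' a'"
    using KA.all_tensors_pure[OF C'] .
  obtain y u where y: "y \<in> carrier K" "u \<in> carrier U" "D = KU.pure_tensor y u"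
    using KU.all_tensors_pure[OF D] by auto
  obtain c b b' where c: "c \<in> carrier K" "b \<in> carrier A" "b' \<in> carrier A"
    "KA.pure_tensor x a = KA.pure_tensor c b" "KA.pure_tensor x' a' = KA.pure_tensor c b'"
    using KA.pure_tensors_common[OF x(1) x'(1) x(2) x'(2)] .
  have CC: "C = KA.pure_tensor c b" "C' = KA.pure_tensor c b'" using c x x' by simp_all
  have add: "C \<oplus>\<^bsub>EA\<^esub> C' = KA.pure_tensor c (b \<oplus>\<^bsub>A\<^esub> b')"
    using KA.pure_tensor_add_right[OF c(1-3)] by (simp add: CC EA_simps)
  have "(C \<oplus>\<^bsub>EA\<^esub> C') \<odot>\<^bsub>EU\<^esub> D = KU.pure_tensor (c \<otimes>\<^bsub>K\<^esub> y) (b \<odot>\<^bsub>U\<^esub> u \<oplus>\<^bsub>U\<^esub> b' \<odot>\<^bsub>U\<^esub> u)"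
    unfolding add y(3) using c y by (simp add: EU_smult_pure act_add_left)
  also have "\<dots> = KU.pure_tensor (c \<otimes>\<^bsub>K\<^esub> y) (b \<odot>\<^bsub>U\<^esub> u) \<oplus>\<^bsub>EU\<^esub> KU.pure_tensor (c \<otimes>\<^bsub>K\<^esub> y) (b' \<odot>\<^bsub>U\<^esub> u)"
    using c y KU.pure_tensor_add_right[of "c \<otimes>\<^bsub>K\<^esub> y" "b \<odot>\<^bsub>U\<^esub> u" "b' \<odot>\<^bsub>U\<^esub> u"] by (simp add: EU_simps)
  also have "\<dots> = C \<odot>\<^bsub>EU\<^esub> D \<oplus>\<^bsub>EU\<^esub> C' \<odot>\<^bsub>EU\<^esub> D"
    using c y by (simp add: EU_smult_pure CC)
  finally show "(C \<oplus>\<^bsub>underlying_ring EA\<^esub> C') \<odot>\<^bsub>EU\<^esub> D = C \<odot>\<^bsub>EU\<^esub> D \<oplus>\<^bsub>EU\<^esub> C' \<odot>\<^bsub>EU\<^esub> D" by simp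
  have "(C \<otimes>\<^bsub>EA\<^esub> C') \<odot>\<^bsub>EU\<^esub> D = C \<odot>\<^bsub>EU\<^esub> (C' \<odot>\<^bsub>EU\<^esub> D)"
    unfolding x(3) x'(3) y(3) using x x' y
    by (simp add: EU_smult_pure EA_mult_pure act_assoc KA.K.m_assoc)
  then show "(C \<otimes>\<^bsub>underlying_ring EA\<^esub> C') \<odot>\<^bsub>EU\<^esub> D = C \<odot>\<^bsub>EU\<^esub> (C' \<odot>\<^bsub>EU\<^esub> D)" by simp
next
  fix C D D' assume "C \<in> carrier (underlying_ring EA)" "D \<in> carrier EU" "D' \<in> carrier EU"
  then have C: "C \<in> carrier KA.T" and D: "D \<in> carrier KU.T" and D': "D' \<in> carrier KU.T"
    by (simp_all add: EA_simps EU_simps)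
  obtain x a where x: "x \<in> carrier K" "a \<in> carrier A" "C = KA.pure_tensor x a"
    using KA.all_tensors_pure[OF C] .
  obtain y u where y: "y \<in> carrier K" "u \<in> carrier V" "D = KU.pure_tensor y u"
    using KU.all_tensors_pure[OF D] .
  obtain y' u' where y': "y' \<in> carrier K" "u' \<in> carrier V" "D' = KU.pure_tensor y' u'"
    using KU.all_tensors_pure[OF D'] .
  obtain c v v' where c: "c \<in> carrier K" "v \<in> carrier V" "v' \<in> carrier V"
    "KU.pure_tensor y u = KU.pure_tensor c v" "KU.pure_tensor y' u' = KU.pure_tensor c v'"
    using KU.pure_tensors_common[OF y(1) y'(1) y(2) y'(2)] .
  have DD: "D = KU.pure_tensor c v" "D' = KU.pure_tensor c v'" using c y y' by simp_all
  have add: "D \<oplus>\<^bsub>EU\<^esub> D' = KU.pure_tensor c (v \<oplus>\<^bsub>U\<^esub> v')"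
    using KU.pure_tensor_add_right[OF c(1-3)] by (simp add: DD EU_simps)
  have "C \<odot>\<^bsub>EU\<^esub> (D \<oplus>\<^bsub>EU\<^esub> D') = KU.pure_tensor (x \<otimes>\<^bsub>K\<^esub> c) (a \<odot>\<^bsub>U\<^esub> v \<oplus>\<^bsub>U\<^esub> a \<odot>\<^bsub>U\<^esub> v')"
    unfolding add x(3) using c x by (simp add: EU_smult_pure act_add_right)
  also have "\<dots> = KU.pure_tensor (x \<otimes>\<^bsub>K\<^esub> c) (a \<odot>\<^bsub>U\<^esub> v) \<oplus>\<^bsub>EU\<^esub> KU.pure_tensor (x \<otimes>\<^bsub>K\<^esub> c) (a \<odot>\<^bsub>U\<^esub> v')"
    using c x KU.pure_tensor_add_right[of "x \<otimes>\<^bsub>K\<^esub> c" "a \<odot>\<^bsub>U\<^esub> v" "a \<odot>\<^bsub>U\<^esub> v'"] by (simp add: EU_simps)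
  also have "\<dots> = C \<odot>\<^bsub>EU\<^esub> D \<oplus>\<^bsub>EU\<^esub> C \<odot>\<^bsub>EU\<^esub> D'"
    using c x by (simp add: EU_smult_pure DD)
  finally show "C \<odot>\<^bsub>EU\<^esub> (D \<oplus>\<^bsub>EU\<^esub> D') = C \<odot>\<^bsub>EU\<^esub> D \<oplus>\<^bsub>EU\<^esub> C \<odot>\<^bsub>EU\<^esub> D'" .
next
  fix D assume "D \<in> carrier EU"
  then have D: "D \<in> carrier KU.T" by (simp add: EU_simps)
  obtain y u where "y \<in> carrier K" "u \<in> carrier V" "D = KU.pure_tensor y u"
    using KU.all_tensors_pure[OF D] .
  then show "\<one>\<^bsub>underlying_ring EA\<^esub> \<odot>\<^bsub>EU\<^esub> D = D"
    by (simp add: EA_simps EU_smult_pure)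
qed

end

context unimodular_generation
begin

text \<open>
  A nonzero element is \<open>c \<otimes> g w = e \<otimes> w\<close> with \<open>w\<close> unimodular and \<open>e = \<iota>(g) c\<close> invertible in \<open>K\<close>. It is sent to
  \<open>y \<otimes> a w\<close> by \<open>y / e \<otimes> a\<close>, and every element of \<open>K \<otimes> U\<close> has that form.
\<close>

lemma extension_simple:
  fixes K :: "'k ring"
  assumes frac: "fraction_field R K \<iota>" and ring: "ring (extend_algebra R K \<iota> A)"
  shows "simple_module (underlying_ring (extend_algebra R K \<iota> A)) (extend_module R K \<iota> A U)"
proof -
  interpret lattice_extension R A U K \<iota>
    by (intro lattice_extension.intro lattice_extension_axioms.intro algebra_lattice_axioms frac)
  obtain u where "u \<in> carrier V" "u \<noteq> \<zero>\<^bsub>V\<^esub>" using nonzero U.M.zero_closed by auto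
  then obtain w f where w: "w \<in> carrier V" "f \<in> functionals R V" "f w = \<one>\<^bsub>R\<^esub>"
    using V.unimodular_factor[OF pid] by metis
  have "carrier EU \<noteq> {\<zero>\<^bsub>EU\<^esub>}"
    using KU.pure_tensor_nonzero[OF w(2,1,3)] KU.pure_tensor_closed[of "\<one>\<^bsub>K\<^esub>" w] w(1)
    by (auto simp: EU_simps simp del: carrier_free_Abelian_group_iff)
  moreover have "N = {\<zero>\<^bsub>EU\<^esub>} \<or> N = carrier EU" if N: "submodule N (underlying_ring EA) EU" for N
  proof -
    interpret N: submodule N "underlying_ring EA" EU by (fact N)
    have "carrier EU \<subseteq> N" if C: "C \<in> N" "C \<noteq> \<zero>\<^bsub>EU\<^esub>" for C
    proof
      have "C \<in> carrier KU.T" using C(1) N.subset by (auto simp: EU_simps)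
      then obtain c u where u: "c \<in> carrier K" "u \<in> carrier V" "C = KU.pure_tensor c u"
        by (rule KU.all_tensors_pure)
      have c0: "c \<noteq> \<zero>\<^bsub>K\<^esub>" and u0: "u \<noteq> \<zero>\<^bsub>V\<^esub>"
        using C(2) u KU.pure_tensor_zero_left KU.pure_tensor_zero_right by (auto simp: EU_simps)
      obtain g w f where g: "g \<in> carrier R" "g \<noteq> \<zero>\<^bsub>R\<^esub>" and w: "w \<in> carrier V"
        and f: "f \<in> functionals R V" "f w = \<one>\<^bsub>R\<^esub>" and ug: "u = g \<odot>\<^bsub>V\<^esub> w"
        using V.unimodular_factor[OF pid u(2) u0] .
      define e where "e = \<iota> g \<otimes>\<^bsub>K\<^esub> c"
      have "\<iota> g \<noteq> \<iota> \<zero>\<^bsub>R\<^esub>"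
        using g frac inj_onD[of \<iota> "carrier R" g "\<zero>\<^bsub>R\<^esub>"] unfolding fraction_field_def by blast
      then have e: "e \<in> Units K" using g(1) u(1) c0 by (simp add: e_def KA.K.field_Units KA.K.integral_iff)
      have Ce: "C = KU.pure_tensor e w"
        using KU.pure_tensor_smult[OF g(1) u(1) w] by (simp add: u(3) ug e_def)
      fix D assume "D \<in> carrier EU"
      then have "D \<in> carrier KU.T" by (simp add: EU_simps)
      then obtain y v where v: "y \<in> carrier K" "v \<in> carrier V" "D = KU.pure_tensor y v"
        by (rule KU.all_tensors_pure)
      obtain a where a: "a \<in> carrier A" "v = a \<odot>\<^bsub>U\<^esub> w"
        using generates[OF f(1) _ f(2)] w v(2) by auto
      have "D = KA.pure_tensor (y \<otimes>\<^bsub>K\<^esub> inv\<^bsub>K\<^esub> e) a \<odot>\<^bsub>EU\<^esub> C"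
        using v a w e KA.K.Units_closed[OF e] by (simp add: Ce EU_smult_pure KA.K.m_assoc)
      also have "\<dots> \<in> N"
        by (rule N.smult_closed[OF _ C(1)])
          (use v e a in \<open>simp add: EA_simps del: carrier_free_Abelian_group_iff\<close>)
      finally show "D \<in> N" .
    qed
    then show ?thesis using N.subset N.one_closed by auto
  qed
  ultimately show ?thesis using EU_left_module[OF ring] unfolding simple_module_def by blast
qed

end

theorem proposition1p12:
  fixes p :: nat
    and R :: "'r ring" and \<pi> :: 'r
    and K :: "'k ring" and \<iota> :: "'r \<Rightarrow> 'k"
    and A :: "('r, 'a) module" and U :: "('a, 'u) module"
  assumes "Factorial_Ring.prime p"
    and "complete_dvr R \<pi>"
    and "has_characteristic (R Quot (PIdl\<^bsub>R\<^esub> \<pi>)) p"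
    and "fraction_field R K \<iota>"
    and "has_characteristic K 0"
    and "symmetric_algebra R A"
    and "split_semisimple_algebra K (extend_algebra R K \<iota> A)"
    and "projective_scalar_property R A"
    and "lattice_over R A U"
    and "projective_module (underlying_ring A) U"
    and "knorr_lattice R A U"
  shows "simple_module (underlying_ring A Quot ((\<lambda>a. \<pi> \<odot>\<^bsub>A\<^esub> a) ` carrier A))
           (quotient_module U ((\<lambda>u. \<pi> \<odot>\<^bsub>restrict_scalars A U\<^esub> u) ` carrier U))
       \<and> simple_module (underlying_ring (extend_algebra R K \<iota> A)) (extend_module R K \<iota> A U)"
proof -
  have pid: "principal_domain R" and \<pi>: "\<pi> \<in> carrier R" and max: "maximalideal (PIdl\<^bsub>R\<^esub> \<pi>) R"
    using assms(2) by (simp_all add: complete_dvr_def discrete_valuation_ring_def)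
  interpret algebra_lattice R A U
    using assms(6,9)
    by (intro algebra_lattice.intro algebra_lattice_axioms.intro)
      (simp_all add: symmetric_algebra_def lattice_over_def)
  obtain s l where s: "symmetrising_form R A s" and l: "l \<in> carrier R"
    and rel: "relative_projective_element R A s (l \<odot>\<^bsub>A\<^esub> \<one>\<^bsub>A\<^esub>)"
    using assms(8) unfolding projective_scalar_property_def by blast
  have "s \<in> linear_forms R A"
    using s unfolding symmetrising_form_def dual_bimodule_isos_def by (auto dest: bij_betwE)
  moreover obtain E d where E: "finite_basis R A E" "dual_basis R A s E d"
    and z: "(\<Oplus>\<^bsub>A\<^esub>x\<in>E. x \<otimes>\<^bsub>A\<^esub> d x) = l \<odot>\<^bsub>A\<^esub> \<one>\<^bsub>A\<^esub>"
    using rel unfolding relative_projective_element_def by metis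
  ultimately interpret dual_bases R A U s E d by unfold_locales
  interpret unimodular_generation R A U
  proof (intro unimodular_generation.intro algebra_lattice_axioms unimodular_generation_axioms.intro pid)
    show "carrier U \<noteq> {\<zero>\<^bsub>U\<^esub>}"
      using assms(11) by (simp add: knorr_lattice_def indecomposable_module_def)
  qed (rule unimodular_generates[OF assms(10,11) l z])
  have "ring (extend_algebra R K \<iota> A)"
    using assms(7) by (simp add: split_semisimple_algebra_def assoc_algebra_def)
  then show ?thesis
    using reduction_simple[OF \<pi> max] extension_simple[OF assms(4)] by blast
qed

end
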